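(* Let $g(A)$ be an infinite dimensional Kac-Moody Lie algebra, i.e. let $A$ be a Cartan matrix which is not of finite type. Then there exist a Cartan matrix $A'$ of finite type and a polynomial $Q'(t)$ such that $$P(A)=\frac{P(A')}{Q'(t)} .$$
   Context: A Cartan matrix is an $n\times n$ integer matrix $A=(a_{ij})$ with $a_{ii}=2$ for all $i$, $a_{ij}\le 0$ for $i\ne j$, and $a_{ij}=0\Rightarrow a_{ji}=0$. Its Weyl group is the Coxeter group $W(A)=\langle \sigma_1,\dots,\sigma_n \mid \sigma_i^2=1,\ (\sigma_i\sigma_j)^{m_{ij}}=1\ (i\ne j)\rangle$, where for $i\neq j$ one puts $m_{ij}=2,3,4,6,\infty$ according as $a_{ij}a_{ji}=0,1,2,3,\ge 4$ respectively (no relation if $m_{ij}=\infty$). Let $l(w)$ be the length of $w\in W(A)$ with respect to the generators. The Poincaré series of $A$ (equivalently of the Kac-Moody Lie algebra $g(A)$) is $P(A)=\sum_{w\in W(A)}t^{l(w)}\in\mathbb{Z}[[t]]$. $A$ is of finite type if it is positive definite (after symmetrization by a positive diagonal matrix), equivalently if $W(A)$ is finite, equivalently if $g(A)$ is finite dimensional (semisimple, not necessarily simple: decomposable matrices are allowed). *)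

theory Defs
  imports
    "HOL-Algebra.Group"
    "HOL-Library.Extended_Nat"
    "HOL-Computational_Algebra.Polynomial_FPS"
    "Jordan_Normal_Form.Matrix"
begin

section \<open>Groups given by generators and relations\<close>

text \<open>
  The letter \<open>(g, False)\<close> stands for the generator \<open>g\<close> and \<open>(g, True)\<close> for its formal inverse.
\<close>

type_synonym 'g word = "('g \<times> bool) list"

definition words :: "'g set \<Rightarrow> 'g word set" where
  "words S = lists (S \<times> UNIV)"

inductive_set word_rel :: "'g set \<Rightarrow> 'g word set \<Rightarrow> ('g word \<times> 'g word) set"
  for S :: "'g set" and R :: "'g word set" where
  refl: "u \<in> words S \<Longrightarrow> (u, u) \<in> word_rel S R"
| sym: "(u, v) \<in> word_rel S R \<Longrightarrow> (v, u) \<in> word_rel S R"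
| trans: "(u, v) \<in> word_rel S R \<Longrightarrow> (v, w) \<in> word_rel S R \<Longrightarrow> (u, w) \<in> word_rel S R"
| cancel: "u \<in> words S \<Longrightarrow> v \<in> words S \<Longrightarrow> g \<in> S \<Longrightarrow>
    (u @ [(g, b), (g, \<not> b)] @ v, u @ v) \<in> word_rel S R"
| relator: "u \<in> words S \<Longrightarrow> v \<in> words S \<Longrightarrow> r \<in> R \<Longrightarrow> r \<in> words S \<Longrightarrow>
    (u @ r @ v, u @ v) \<in> word_rel S R"

definition presented_group :: "'g set \<Rightarrow> 'g word set \<Rightarrow> 'g word set monoid" where
  "presented_group S R = \<lparr>
     carrier = words S // word_rel S R,
     mult = (\<lambda>X Y. \<Union>u\<in>X. \<Union>v\<in>Y. word_rel S R `` {u @ v}),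
     one = word_rel S R `` {[]} \<rparr>"

definition presented_gen :: "'g set \<Rightarrow> 'g word set \<Rightarrow> 'g \<Rightarrow> 'g word set" where
  "presented_gen S R g = word_rel S R `` {[(g, False)]}"

text \<open>
  Only products of elements of \<open>X\<close> itself are considered, not of their inverses; for the
  involutive generators of a Coxeter group this makes no difference.
\<close>

definition gen_length :: "('a, 'b) monoid_scheme \<Rightarrow> 'a set \<Rightarrow> 'a \<Rightarrow> nat" where
  "gen_length G X w =
     (LEAST k. \<exists>xs. set xs \<subseteq> X \<and> length xs = k \<and> foldr (mult G) xs (one G) = w)"

section \<open>Cartan matrices\<close>

definition cartan_matrix :: "nat \<Rightarrow> int mat \<Rightarrow> bool" where
  "cartan_matrix n A \<longleftrightarrow> 0 < n \<and> A \<in> carrier_mat n n \<and>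
     (\<forall>i<n. A $$ (i, i) = 2) \<and>
     (\<forall>i<n. \<forall>j<n. i \<noteq> j \<longrightarrow> A $$ (i, j) \<le> 0) \<and>
     (\<forall>i<n. \<forall>j<n. A $$ (i, j) = 0 \<longrightarrow> A $$ (j, i) = 0)"

definition positive_definite :: "real mat \<Rightarrow> bool" where
  "positive_definite M \<longleftrightarrow>
     (\<exists>n. M \<in> carrier_mat n n \<and> transpose_mat M = M \<and>
       (\<forall>x \<in> carrier_vec n. x \<noteq> 0\<^sub>v n \<longrightarrow> scalar_prod x (M *\<^sub>v x) > 0))"

definition finite_type :: "int mat \<Rightarrow> bool" where
  "finite_type A \<longleftrightarrow>
     (\<exists>d. (\<forall>i<dim_row A. 0 < d i) \<and>
       positive_definite (mat_diag (dim_row A) d * map_mat real_of_int A))"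

section \<open>The Weyl group and its Poincare series\<close>

definition coxeter_exponent :: "int mat \<Rightarrow> nat \<Rightarrow> nat \<Rightarrow> enat" where
  "coxeter_exponent A i j =
     (let p = A $$ (i, j) * A $$ (j, i) in
        if p = 0 then 2 else if p = 1 then 3 else if p = 2 then 4 else if p = 3 then 6 else \<infinity>)"

definition weyl_relators :: "int mat \<Rightarrow> nat word set" where
  "weyl_relators A =
     {[(i, False), (i, False)] | i. i < dim_row A} \<union>
     {concat (replicate m [(i, False), (j, False)]) | i j m.
        i < dim_row A \<and> j < dim_row A \<and> i \<noteq> j \<and> coxeter_exponent A i j = enat m}"

definition weyl_group :: "int mat \<Rightarrow> nat word set monoid" where
  "weyl_group A = presented_group {..<dim_row A} (weyl_relators A)"

definition weyl_gens :: "int mat \<Rightarrow> nat word set set" where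
  "weyl_gens A = presented_gen {..<dim_row A} (weyl_relators A) ` {..<dim_row A}"

definition weyl_length :: "int mat \<Rightarrow> nat word set \<Rightarrow> nat" where
  "weyl_length A w = gen_length (weyl_group A) (weyl_gens A) w"

definition poincare_series :: "int mat \<Rightarrow> int fps" where
  "poincare_series A =
     Abs_fps (\<lambda>k. int (card {w \<in> carrier (weyl_group A). weyl_length A w = k}))"

section \<open>Well-definedness\<close>

lemma word_rel_words:
  "(u, v) \<in> word_rel S R \<Longrightarrow> u \<in> words S \<and> v \<in> words S"
  by (induction rule: word_rel.induct) (auto simp: words_def)

lemma equiv_word_rel: "equiv (words S) (word_rel S R)"
proof (rule equivI)
  show "word_rel S R \<subseteq> words S \<times> words S" using word_rel_words by fastforce
  show "refl_on (words S) (word_rel S R)"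
    by (auto intro!: refl_onI intro: word_rel.refl dest: word_rel_words)
  show "Relation.sym (word_rel S R)" by (auto intro: symI word_rel.sym)
  show "Relation.trans (word_rel S R)" by (meson transI word_rel.trans)
qed

lemma word_rel_append:
  assumes "(u, v) \<in> word_rel S R" "x \<in> words S" "y \<in> words S"
  shows "(x @ u @ y, x @ v @ y) \<in> word_rel S R"
  using assms
proof (induction rule: word_rel.induct)
  case (cancel u v g b)
  then show ?case
    using word_rel.cancel[of "x @ u" S "v @ y" g b R] by (simp add: words_def)
next
  case (relator u v r)
  then show ?case
    using word_rel.relator[of "x @ u" S "v @ y" r R] by (simp add: words_def)
next
  case (refl u)
  then show ?case by (auto simp: words_def intro: word_rel.refl)
next
  case (sym u v)
  then show ?case by (metis word_rel.sym)
next
  case (trans u v w)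
  then show ?case by (metis word_rel.trans)
qed

lemma word_rel_append2:
  assumes "(u, u') \<in> word_rel S R" "(v, v') \<in> word_rel S R"
  shows "(u @ v, u' @ v') \<in> word_rel S R"
proof (rule word_rel.trans)
  have nil: "[] \<in> words S" by (simp add: words_def)
  show "(u @ v, u' @ v) \<in> word_rel S R"
    using word_rel_append[OF assms(1) nil, of v] word_rel_words[OF assms(2)] by simp
  show "(u' @ v, u' @ v') \<in> word_rel S R"
    using word_rel_append[OF assms(2) _ nil, of u'] word_rel_words[OF assms(1)] by simp
qed

lemma presented_mult:
  assumes "u \<in> words S" "v \<in> words S"
  shows "mult (presented_group S R) (word_rel S R `` {u}) (word_rel S R `` {v})
    = word_rel S R `` {u @ v}"
proof -
  have "word_rel S R `` {u' @ v'} = word_rel S R `` {u @ v}"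
    if "(u, u') \<in> word_rel S R" "(v, v') \<in> word_rel S R" for u' v'
    using equiv_class_eq[OF equiv_word_rel word_rel_append2[OF that]] by simp
  then have "(\<Union>u'\<in>word_rel S R `` {u}. \<Union>v'\<in>word_rel S R `` {v}. word_rel S R `` {u' @ v'})
    = (\<Union>u'\<in>word_rel S R `` {u}. \<Union>v'\<in>word_rel S R `` {v}. word_rel S R `` {u @ v})"
    by (intro SUP_cong HOL.refl) simp
  moreover have "word_rel S R `` {u} \<noteq> {}" "word_rel S R `` {v} \<noteq> {}"
    using assms word_rel.refl by blast+
  ultimately show ?thesis
    by (simp add: presented_group_def)
qed

lemma presented_inverse:
  "u \<in> words S \<Longrightarrow> (rev (map (\<lambda>(g, b). (g, \<not> b)) u) @ u, []) \<in> word_rel S R"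
proof (induction u)
  case Nil
  then show ?case by (auto intro: word_rel.refl)
next
  case (Cons a u)
  obtain g b where a: "a = (g, b)" by (cases a)
  let ?v = "rev (map (\<lambda>(g, b). (g, \<not> b)) u)"
  have w: "?v \<in> words S" "u \<in> words S" "g \<in> S" using Cons.prems a by (auto simp: words_def)
  have "(?v @ [(g, \<not> b), (g, b)] @ u, []) \<in> word_rel S R"
    using word_rel.trans[OF word_rel.cancel[OF w, of "\<not> b" R] Cons.IH[OF w(2)]]
    unfolding not_not .
  moreover have "rev (map (\<lambda>(g, b). (g, \<not> b)) (a # u)) @ a # u = ?v @ [(g, \<not> b), (g, b)] @ u"
    unfolding a by (simp only: list.map rev.simps prod.case append.simps append_assoc)
  ultimately show ?case by (simp only:)
qed

lemma group_presented_group: "group (presented_group S R)"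
proof (rule groupI)
  let ?G = "presented_group S R" and ?c = "\<lambda>u. word_rel S R `` {u}"
  have I: "?c u \<in> carrier ?G" if "u \<in> words S" for u
    using that by (simp add: presented_group_def quotientI)
  have E: "\<exists>u. u \<in> words S \<and> x = ?c u" if "x \<in> carrier ?G" for x
    using that unfolding presented_group_def by (auto elim: quotientE)
  have app: "u @ v \<in> words S" if "u \<in> words S" "v \<in> words S" for u v :: "'a word"
    using that by (simp add: words_def)
  have nil: "[] \<in> words S" and one: "one ?G = ?c []"
    by (simp_all add: words_def presented_group_def)
  show "one ?G \<in> carrier ?G" unfolding one by (rule I[OF nil])
  fix x assume "x \<in> carrier ?G"
  then obtain u where u: "u \<in> words S" and x: "x = ?c u" using E by meson
  show "mult ?G (one ?G) x = x"
    unfolding x one presented_mult[OF nil u] by simp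
  let ?v = "rev (map (\<lambda>(g, b). (g, \<not> b)) u)"
  have inv: "(?v @ u, []) \<in> word_rel S R" by (rule presented_inverse[OF u])
  have v: "?v \<in> words S" using u by (auto simp: words_def)
  have "mult ?G (?c ?v) x = one ?G"
    unfolding x one presented_mult[OF v u] by (rule equiv_class_eq[OF equiv_word_rel inv])
  then show "\<exists>y \<in> carrier ?G. mult ?G y x = one ?G" using I[OF v] by (rule bexI)
  fix y assume "y \<in> carrier ?G"
  then obtain v where v: "v \<in> words S" and y: "y = ?c v" using E by meson
  show "mult ?G x y \<in> carrier ?G"
    unfolding x y presented_mult[OF u v] by (rule I[OF app[OF u v]])
  fix z assume "z \<in> carrier ?G"
  then obtain w where w: "w \<in> words S" and z: "z = ?c w" using E by meson
  show "mult ?G (mult ?G x y) z = mult ?G x (mult ?G y z)"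
    unfolding x y z presented_mult[OF u v] presented_mult[OF v w]
      presented_mult[OF app[OF u v] w] presented_mult[OF u app[OF v w]] by simp
qed

lemma group_weyl_group: "group (weyl_group A)"
  by (simp add: weyl_group_def group_presented_group)

lemma weyl_letter:
  assumes "i < dim_row A"
  shows "([(i, b)], [(i, False)]) \<in> word_rel {..<dim_row A} (weyl_relators A)"
proof (cases b)
  case True
  let ?S = "{..<dim_row A}" and ?R = "weyl_relators A"
  have w: "[] \<in> words ?S" "[(i, b)] \<in> words ?S" for b using assms by (auto simp: words_def)
  have r: "[(i, False), (i, False)] \<in> ?R" "[(i, False), (i, False)] \<in> words ?S"
    using assms by (auto simp: weyl_relators_def words_def)
  have "([(i, True), (i, False), (i, False)], [(i, True)]) \<in> word_rel ?S ?R"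
    using word_rel.relator[OF w(2)[of True] w(1) r] by simp
  moreover have "([(i, True), (i, False), (i, False)], [(i, False)]) \<in> word_rel ?S ?R"
    using word_rel.cancel[OF w(1) w(2)[of False], of i True ?R] assms
    unfolding append_Nil append_Cons not_True_eq_False by blast
  ultimately have "([(i, True)], [(i, False)]) \<in> word_rel ?S ?R"
    by (rule word_rel.trans[OF word_rel.sym])
  then show ?thesis using True by (simp only:)
qed (use assms in \<open>auto simp: words_def intro: word_rel.refl\<close>)

lemma weyl_generated:
  assumes "w \<in> carrier (weyl_group A)"
  shows "\<exists>xs. set xs \<subseteq> weyl_gens A \<and>
    foldr (mult (weyl_group A)) xs (one (weyl_group A)) = w"
proof -
  let ?S = "{..<dim_row A}" and ?R = "weyl_relators A"
  have "\<exists>xs. set xs \<subseteq> weyl_gens A \<and>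
    foldr (mult (weyl_group A)) xs (one (weyl_group A)) = word_rel ?S ?R `` {u}"
    if "u \<in> words ?S" for u
    using that
  proof (induction u)
    case Nil
    then show ?case by (intro exI[of _ "[]"]) (simp add: weyl_group_def presented_group_def)
  next
    case (Cons a u)
    obtain i b where a: "a = (i, b)" by (cases a)
    have i: "i < dim_row A" and u: "u \<in> words ?S" using Cons.prems a by (auto simp: words_def)
    obtain xs where xs: "set xs \<subseteq> weyl_gens A"
      "foldr (mult (weyl_group A)) xs (one (weyl_group A)) = word_rel ?S ?R `` {u}"
      using Cons.IH[OF u] by blast
    have "word_rel ?S ?R `` {[(i, False)] @ u} = word_rel ?S ?R `` {a # u}"
      using equiv_class_eq[OF equiv_word_rel
          word_rel_append2[OF weyl_letter[OF i, of b] word_rel.refl[OF u]]]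
      by (simp add: a)
    moreover have "[(i, False)] \<in> words ?S" using i by (simp add: words_def)
    ultimately show ?case
      using xs u i presented_mult[of "[(i, False)]" ?S u ?R]
      by (intro exI[of _ "presented_gen ?S ?R i # xs"])
        (auto simp: weyl_gens_def weyl_group_def presented_gen_def)
  qed
  then show ?thesis
    using assms by (auto simp: weyl_group_def presented_group_def quotient_def)
qed

lemma finite_weyl_length: "finite {w \<in> carrier (weyl_group A). weyl_length A w = k}"
proof (rule finite_subset)
  let ?f = "\<lambda>xs. foldr (mult (weyl_group A)) xs (one (weyl_group A))"
  show "{w \<in> carrier (weyl_group A). weyl_length A w = k}
    \<subseteq> ?f ` {xs. set xs \<subseteq> weyl_gens A \<and> length xs = k}"
  proof clarify
    fix w assume w: "w \<in> carrier (weyl_group A)"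
    let ?P = "\<lambda>m. \<exists>xs. set xs \<subseteq> weyl_gens A \<and> length xs = m \<and> ?f xs = w"
    have "?P (weyl_length A w)"
      unfolding weyl_length_def gen_length_def
      using weyl_generated[OF w] by (intro LeastI_ex[of ?P]) blast
    then show "w \<in> ?f ` {xs. set xs \<subseteq> weyl_gens A \<and> length xs = weyl_length A w}" by auto
  qed
  show "finite (?f ` {xs. set xs \<subseteq> weyl_gens A \<and> length xs = k})"
    by (intro finite_imageI finite_lists_length_eq) (simp add: weyl_gens_def)
qed

end

theory Submission
  imports Defs
begin

text \<open>
  Write \<open>W(t)\<close> for the Poincare series of the Weyl group \<open>W\<close> of \<open>A\<close>, and for a set \<open>J\<close> of indices
  write \<open>W\<^sub>J(t)\<close> for the series of the principal submatrix on \<open>J\<close> and \<open>W\<^sup>J(t)\<close> for the generating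
  function by length of the elements that every generator in \<open>J\<close> lengthens.

  The group \<open>W\<close> acts on the lattice spanned by the simple roots, and the action knows the length:
  the \<open>i\<close>-th generator lengthens \<open>w\<close> from the right exactly if \<open>w \<alpha>\<^sub>i\<close> has nonnegative coordinates
  (\<open>ascent_root_nonneg\<close>). Three things follow. The parabolic factorisation
  \<open>W\<^sup>J(t) W\<^sub>J(t) = W(t)\<close> holds (\<open>poincare_parabolic\<close>). An element that every generator shortens is
  longest, so that it exists only if \<open>W\<close> is finite (\<open>finite_if_all_descents\<close>). And the Cartan
  matrix of a finite \<open>W\<close> is of finite type, because averaging over \<open>W\<close> yields an invariant inner
  product (\<open>finite_imp_finite_type\<close>).

  Let \<open>W\<close> be infinite. Every element has an ascent, hence inclusion and exclusion over its set of
  ascents gives \<open>\<Sum>\<^sub>J (-1)\<^bsup>|J|\<^esup> W\<^sup>J(t) = 0\<close> (\<open>alternating_sum_zero\<close>). The full index set contributes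
  \<open>\<plusminus> 1\<close>. Division by \<open>W(t)\<close> turns this into an expression of \<open>1 / W(t)\<close> as a signed sum of
  \<open>1 / W\<^sub>J(t)\<close> over the proper subsets \<open>J\<close>. By induction on the rank each of these is a polynomial
  divided by the Poincare polynomial of a finite Weyl group. The direct sum of Cartan matrices
  multiplies Poincare series (\<open>poincare_direct_sum\<close>), so the direct sum of all matrices involved has
  a common denominator as its Poincare polynomial, and it is of finite type because its Weyl
  group is finite. Thus \<open>1 / W(t)\<close> is again such a quotient. If \<open>W\<close> is finite, \<open>A\<close> itself is a
  denominator.
\<close>

section \<open>The action on the root lattice\<close>

definition weyl_elt :: "int mat \<Rightarrow> nat list \<Rightarrow> nat word set" where
  "weyl_elt A xs = word_rel {..<dim_row A} (weyl_relators A) `` {map (\<lambda>i. (i, False)) xs}"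

definition word_length :: "int mat \<Rightarrow> nat list \<Rightarrow> nat" where
  "word_length A xs = weyl_length A (weyl_elt A xs)"

text \<open>
  Vectors are functions \<open>nat \<Rightarrow> int\<close> in the coordinates given by the simple roots; coordinates
  from \<open>dim_row A\<close> on are carried along and never changed. The pairing below is the evaluation of
  a vector at the \<open>i\<close>-th simple coroot, so that \<open>reflect\<close> is the usual simple reflection.
\<close>

definition simple_root :: "nat \<Rightarrow> nat \<Rightarrow> int" where
  "simple_root i = (\<lambda>k. if k = i then 1 else 0)"

definition pairing :: "int mat \<Rightarrow> nat \<Rightarrow> (nat \<Rightarrow> int) \<Rightarrow> int" where
  "pairing A i x = (\<Sum>k<dim_row A. A $$ (i, k) * x k)"

definition reflect :: "int mat \<Rightarrow> nat \<Rightarrow> (nat \<Rightarrow> int) \<Rightarrow> nat \<Rightarrow> int" where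
  "reflect A i x = (\<lambda>k. x k - pairing A i x * simple_root i k)"

definition act :: "int mat \<Rightarrow> nat list \<Rightarrow> (nat \<Rightarrow> int) \<Rightarrow> nat \<Rightarrow> int" where
  "act A xs = foldr (reflect A) xs"

lemma simple_root_nonneg: "0 \<le> simple_root i l"
  by (simp add: simple_root_def)

lemma act_Nil [simp]: "act A [] x = x"
  and act_Cons [simp]: "act A (i # xs) x = reflect A i (act A xs x)"
  and act_append: "act A (xs @ ys) x = act A xs (act A ys x)"
  by (simp_all add: act_def)

lemma pairing_add: "pairing A i (\<lambda>k. x k + y k) = pairing A i x + pairing A i y"
  and pairing_diff: "pairing A i (\<lambda>k. x k - y k) = pairing A i x - pairing A i y"
  and pairing_scale: "pairing A i (\<lambda>k. c * x k) = c * pairing A i x"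
  and pairing_root: "j < dim_row A \<Longrightarrow> pairing A i (simple_root j) = A $$ (i, j)"
  by (simp_all add: pairing_def sum.distrib sum_subtractf algebra_simps sum_distrib_left
      simple_root_def if_distrib sum.delta cong: if_cong)

lemma pairing_sum:
  "pairing A i (\<lambda>k. \<Sum>j\<in>J. c j * y j k) = (\<Sum>j\<in>J. c j * pairing A i (y j))"
  unfolding pairing_def sum_distrib_left by (subst sum.swap) (simp add: algebra_simps)

lemma reflect_sum:
  "reflect A i (\<lambda>k. \<Sum>j\<in>J. c j * y j k) = (\<lambda>k. \<Sum>j\<in>J. c j * reflect A i (y j) k)"
  by (auto simp: reflect_def pairing_sum sum_subtractf algebra_simps sum_distrib_left sum_distrib_right)

lemma act_sum:
  "act A xs (\<lambda>k. \<Sum>j\<in>J. c j * y j k) = (\<lambda>k. \<Sum>j\<in>J. c j * act A xs (y j) k)"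
  by (induction xs) (simp_all add: reflect_sum)

lemma act_comb:
  "act A xs (\<lambda>k. p * x k + q * y k) = (\<lambda>k. p * act A xs x k + q * act A xs y k)"
  using act_sum[of A xs "\<lambda>j::bool. if j then p else q" "\<lambda>j. if j then x else y" UNIV]
  by (simp add: UNIV_bool add.commute)

locale cartan =
  fixes A :: "int mat"
  assumes cartan: "cartan_matrix (dim_row A) A"
begin

abbreviation n where "n \<equiv> dim_row A"

abbreviation valid :: "nat list \<Rightarrow> bool" where "valid xs \<equiv> set xs \<subseteq> {..<n}"

abbreviation rel where "rel \<equiv> word_rel {..<n} (weyl_relators A)"

lemma diag: "i < n \<Longrightarrow> A $$ (i, i) = 2"
  and off_diag: "i < n \<Longrightarrow> j < n \<Longrightarrow> i \<noteq> j \<Longrightarrow> A $$ (i, j) \<le> 0"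
  and zero_sym: "i < n \<Longrightarrow> j < n \<Longrightarrow> A $$ (i, j) = 0 \<Longrightarrow> A $$ (j, i) = 0"
  using cartan by (auto simp: cartan_matrix_def)

lemma reflect_twice: "i < n \<Longrightarrow> reflect A i (reflect A i x) = x"
  by (auto simp: reflect_def pairing_diff pairing_scale pairing_root diag fun_eq_iff)

text \<open>
  Two simple reflections move a vector only inside the plane through it that is spanned by their
  two roots. In plane coordinates the maps are affine, so that the braid relations become the
  finitely many numerical computations of \<open>act_relator\<close>.
\<close>

lemma reflect_plane:
  assumes "i < n" "j < n"
  shows "reflect A i (\<lambda>k. x k + (c * simple_root i k + d * simple_root j k)) =
    (\<lambda>k. x k + ((- c - pairing A i x - d * A $$ (i, j)) * simple_root i k + d * simple_root j k))"
  using assms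
  by (auto simp: reflect_def pairing_add pairing_scale pairing_root diag fun_eq_iff algebra_simps)

lemma reflect_plane':
  assumes "i < n" "j < n"
  shows "reflect A j (\<lambda>k. x k + (c * simple_root i k + d * simple_root j k)) =
    (\<lambda>k. x k + (c * simple_root i k + (- d - pairing A j x - c * A $$ (j, i)) * simple_root j k))"
  using assms
  by (auto simp: reflect_def pairing_add pairing_scale pairing_root diag fun_eq_iff algebra_simps)

lemma small_product:
  fixes a b :: int
  assumes "a \<le> 0" "b \<le> 0" "a * b \<in> {1, 2, 3}"
  shows "(a, b) \<in> {(-1, -1), (-1, -2), (-2, -1), (-1, -3), (-3, -1)}"
proof -
  have "\<bar>a\<bar> \<le> \<bar>a * b\<bar>"
    using assms(3) by (intro dvd_imp_le_int) auto
  then have "a \<in> {-3, -2, -1, 0}" using assms(1,3) by auto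
  then show ?thesis using assms(2,3) by auto
qed

lemma exponent_cases:
  assumes "i < n" "j < n" "i \<noteq> j" "coxeter_exponent A i j = enat m"
  shows "(A $$ (i, j), A $$ (j, i), m) \<in>
    {(0, 0, 2), (-1, -1, 3), (-1, -2, 4), (-2, -1, 4), (-1, -3, 6), (-3, -1, 6)}"
proof -
  let ?a = "A $$ (i, j)" and ?b = "A $$ (j, i)"
  have ab: "?a \<le> 0" "?b \<le> 0" "?a = 0 \<longleftrightarrow> ?b = 0" using assms off_diag zero_sym by blast+
  have "?a * ?b \<in> {0, 1, 2, 3}"
    using assms(4) by (auto simp: coxeter_exponent_def Let_def split: if_splits)
  then have "?a * ?b = 0 \<or> ?a * ?b \<in> {1, 2, 3}" by blast
  then have "(?a, ?b) \<in> {(0, 0), (-1, -1), (-1, -2), (-2, -1), (-1, -3), (-3, -1)}"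
    using small_product[OF ab(1,2)] ab(3) by (elim disjE) (simp, blast)
  then show ?thesis
    using assms(4)
    by (elim insertE emptyE; simp only: prod.inject; elim conjE)
      (simp_all add: coxeter_exponent_def numeral_eq_enat)
qed

lemma act_relator:
  assumes "i < n" "j < n" "i \<noteq> j" "coxeter_exponent A i j = enat m"
  shows "act A (concat (replicate m [i, j])) x = x"
proof -
  define u v where "u = pairing A i x" and "v = pairing A j x"
  define P where "P c d = (\<lambda>k. x k + (c * simple_root i k + d * simple_root j k))" for c d
  have R: "reflect A i (P c d) = P (- c - u - d * A $$ (i, j)) d"
    "reflect A j (P c d) = P c (- d - v - c * A $$ (j, i))" for c d
    unfolding P_def u_def v_def
    by (rule reflect_plane[OF assms(1,2)] reflect_plane'[OF assms(1,2)])+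
  have m: "(2::nat) = Suc (Suc 0)" "(3::nat) = Suc (Suc (Suc 0))"
    "(4::nat) = Suc (Suc (Suc (Suc 0)))" "(6::nat) = Suc (Suc (Suc (Suc (Suc (Suc 0)))))"
    by simp_all
  have "act A (concat (replicate m [i, j])) (P 0 0) = P 0 0"
    using exponent_cases[OF assms]
    by (elim insertE emptyE; simp only: prod.inject; elim conjE)
      (simp_all add: m R algebra_simps)
  moreover have "P 0 0 = x" by (simp add: P_def)
  ultimately show ?thesis by simp
qed

end

section \<open>Words and their lengths\<close>

definition weyl_word :: "int mat \<Rightarrow> nat word set \<Rightarrow> nat list" where
  "weyl_word A w = (SOME xs. set xs \<subseteq> {..<dim_row A} \<and> weyl_elt A xs = w)"

context cartan
begin

lemma act_rel: "(u, v) \<in> rel \<Longrightarrow> act A (map fst u) = act A (map fst v)"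
proof (induction rule: word_rel.induct)
  case (cancel u v g b)
  then show ?case by (intro ext) (simp add: act_append reflect_twice)
next
  case (relator u v r)
  have "act A (map fst r) x = x" for x
    using relator(3) act_relator
    by (auto simp: weyl_relators_def reflect_twice map_concat)
  then show ?case by (intro ext) (simp add: act_append)
qed auto

text \<open>
  All relators have even length. This sign character makes multiplication by a generator change
  the length by exactly one.
\<close>

lemma even_length_rel: "(u, v) \<in> rel \<Longrightarrow> even (length u) \<longleftrightarrow> even (length v)"
proof (induction rule: word_rel.induct)
  case (relator u v r)
  have "even (length r)"
    using relator(3) by (auto simp: weyl_relators_def length_concat sum_list_replicate)
  then show ?case by auto
qed auto

lemma valid_words: "valid xs \<Longrightarrow> map (\<lambda>i. (i, False)) xs \<in> words {..<n}"
  by (auto simp: words_def)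

lemma elt_eq_iff:
  "valid xs \<Longrightarrow> valid ys \<Longrightarrow> weyl_elt A xs = weyl_elt A ys \<longleftrightarrow>
    (map (\<lambda>i. (i, False)) xs, map (\<lambda>i. (i, False)) ys) \<in> rel"
  unfolding weyl_elt_def by (rule eq_equiv_class_iff[OF equiv_word_rel valid_words valid_words])

lemma elt_act: "weyl_elt A xs = weyl_elt A ys \<Longrightarrow> valid xs \<Longrightarrow> valid ys \<Longrightarrow> act A xs = act A ys"
  using act_rel[of "map (\<lambda>i. (i, False)) xs" "map (\<lambda>i. (i, False)) ys"]
  by (simp add: elt_eq_iff comp_def)

lemma elt_even:
  "weyl_elt A xs = weyl_elt A ys \<Longrightarrow> valid xs \<Longrightarrow> valid ys \<Longrightarrow> even (length xs) \<longleftrightarrow> even (length ys)"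
  using even_length_rel[of "map (\<lambda>i. (i, False)) xs" "map (\<lambda>i. (i, False)) ys"]
  by (simp add: elt_eq_iff)

lemma elt_append:
  "weyl_elt A xs = weyl_elt A xs' \<Longrightarrow> weyl_elt A ys = weyl_elt A ys' \<Longrightarrow>
    valid xs \<Longrightarrow> valid xs' \<Longrightarrow> valid ys \<Longrightarrow> valid ys' \<Longrightarrow>
    weyl_elt A (xs @ ys) = weyl_elt A (xs' @ ys')"
  using word_rel_append2[of "map (\<lambda>i. (i, False)) xs" "map (\<lambda>i. (i, False)) xs'" "{..<n}"
    "weyl_relators A" "map (\<lambda>i. (i, False)) ys" "map (\<lambda>i. (i, False)) ys'"]
  by (simp add: elt_eq_iff)

lemma elt_mult:
  "valid xs \<Longrightarrow> valid ys \<Longrightarrow>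
    weyl_elt A xs \<otimes>\<^bsub>weyl_group A\<^esub> weyl_elt A ys = weyl_elt A (xs @ ys)"
  by (simp add: weyl_elt_def weyl_group_def presented_mult valid_words)

lemma elt_Nil: "\<one>\<^bsub>weyl_group A\<^esub> = weyl_elt A []"
  by (simp add: weyl_elt_def weyl_group_def presented_group_def)

lemma elt_relator_Nil:
  assumes "map (\<lambda>i. (i, False)) r \<in> weyl_relators A" "valid r"
  shows "weyl_elt A r = weyl_elt A []"
proof -
  have "([] @ map (\<lambda>i. (i, False)) r @ [], [] @ []) \<in> rel"
    by (rule word_rel.relator[OF _ _ assms(1) valid_words[OF assms(2)]]) (simp_all add: words_def)
  then show ?thesis using assms(2) by (simp add: elt_eq_iff)
qed

lemma elt_square: "i < n \<Longrightarrow> weyl_elt A [i, i] = weyl_elt A []"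
  by (rule elt_relator_Nil) (auto simp: weyl_relators_def)

lemma elt_braid:
  assumes "i < n" "j < n" "i \<noteq> j" "coxeter_exponent A i j = enat m"
  shows "weyl_elt A (concat (replicate m [i, j])) = weyl_elt A []"
proof (rule elt_relator_Nil)
  have "map (\<lambda>i. (i, False)) (concat (replicate m [i, j])) = concat (replicate m [(i, False), (j, False)])"
    by (simp add: map_concat)
  then show "map (\<lambda>i. (i, False)) (concat (replicate m [i, j])) \<in> weyl_relators A"
    using assms by (auto simp: weyl_relators_def)
qed (use assms in auto)

lemma elt_cancel:
  assumes "i < n" "valid xs" "valid ys"
  shows "weyl_elt A (xs @ i # i # ys) = weyl_elt A (xs @ ys)"
proof -
  have "weyl_elt A ([i, i] @ ys) = weyl_elt A ([] @ ys)"
    by (rule elt_append[OF elt_square HOL.refl]) (use assms in auto)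
  then have "weyl_elt A (i # i # ys) = weyl_elt A ys" by simp
  then show ?thesis
    by (rule elt_append[OF HOL.refl]) (use assms in auto)
qed

lemma elt_rev: "valid xs \<Longrightarrow> weyl_elt A (rev xs @ xs) = weyl_elt A []"
proof (induction xs)
  case (Cons i xs)
  then show ?case using elt_cancel[of i "rev xs" xs] by auto
qed simp

lemma elt_rev': "valid xs \<Longrightarrow> weyl_elt A (xs @ rev xs) = weyl_elt A []"
  using elt_rev[of "rev xs"] by simp

lemma elt_cancel_left:
  assumes "weyl_elt A (xs @ ys) = weyl_elt A (xs @ zs)" "valid xs" "valid ys" "valid zs"
  shows "weyl_elt A ys = weyl_elt A zs"
proof -
  have *: "weyl_elt A (rev xs @ xs @ us) = weyl_elt A us" if "valid us" for us
    using elt_append[OF elt_rev[OF assms(2)] HOL.refl[of "weyl_elt A us"]] assms(2) that by simp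
  have "weyl_elt A (rev xs @ xs @ ys) = weyl_elt A (rev xs @ xs @ zs)"
    by (rule elt_append[OF HOL.refl assms(1)]) (use assms in auto)
  then show ?thesis using *[OF assms(3)] *[OF assms(4)] by simp
qed

lemma elt_move_right:
  assumes "weyl_elt A (xs @ ys) = weyl_elt A zs" "valid xs" "valid ys" "valid zs"
  shows "weyl_elt A xs = weyl_elt A (zs @ rev ys)"
proof -
  have "weyl_elt A ((xs @ ys) @ rev ys) = weyl_elt A (zs @ rev ys)"
    by (rule elt_append[OF assms(1) HOL.refl]) (use assms in auto)
  moreover have "weyl_elt A (xs @ (ys @ rev ys)) = weyl_elt A (xs @ [])"
    by (rule elt_append[OF HOL.refl elt_rev']) (use assms in auto)
  ultimately show ?thesis by simp
qed

lemma foldr_gens: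
  "valid xs \<Longrightarrow> foldr (mult (weyl_group A)) (map (presented_gen {..<n} (weyl_relators A)) xs)
    (one (weyl_group A)) = weyl_elt A xs"
proof (induction xs)
  case (Cons i xs)
  have "presented_gen {..<n} (weyl_relators A) i = weyl_elt A [i]"
    by (simp add: presented_gen_def weyl_elt_def)
  then show ?case using Cons elt_mult[of "[i]" xs] by simp
qed (simp add: elt_Nil)

lemma gens_word:
  assumes "set gs \<subseteq> weyl_gens A"
  shows "\<exists>xs. valid xs \<and> gs = map (presented_gen {..<n} (weyl_relators A)) xs"
  using assms
proof (induction gs)
  case (Cons g gs)
  then obtain i xs where "i < n" "g = presented_gen {..<n} (weyl_relators A) i" "valid xs"
    "gs = map (presented_gen {..<n} (weyl_relators A)) xs"
    by (auto simp: weyl_gens_def)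
  then show ?case by (intro exI[of _ "i # xs"]) simp
qed simp

lemma carrier_word: "w \<in> carrier (weyl_group A) \<Longrightarrow> \<exists>xs. valid xs \<and> weyl_elt A xs = w"
  using weyl_generated gens_word foldr_gens by metis

lemma weyl_word:
  assumes "w \<in> carrier (weyl_group A)"
  shows "valid (weyl_word A w)" "weyl_elt A (weyl_word A w) = w"
  unfolding weyl_word_def using someI_ex[OF carrier_word[OF assms]] by auto

lemma elt_carrier: "valid xs \<Longrightarrow> weyl_elt A xs \<in> carrier (weyl_group A)"
  by (simp add: weyl_elt_def weyl_group_def presented_group_def quotientI valid_words)

lemma word_length_Least:
  "word_length A xs = (LEAST k. \<exists>ys. valid ys \<and> length ys = k \<and> weyl_elt A ys = weyl_elt A xs)"
proof -
  let ?f = "\<lambda>gs. foldr (mult (weyl_group A)) gs (one (weyl_group A))"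
  have "(\<exists>gs. set gs \<subseteq> weyl_gens A \<and> length gs = k \<and> ?f gs = w) \<longleftrightarrow>
    (\<exists>ys. valid ys \<and> length ys = k \<and> weyl_elt A ys = w)" (is "?l \<longleftrightarrow> ?r") for k w
  proof
    assume ?l
    then show ?r using gens_word foldr_gens by (metis length_map)
  next
    assume ?r
    then obtain ys where ys: "valid ys" "length ys = k" "weyl_elt A ys = w" by blast
    then show ?l
      by (intro exI[of _ "map (presented_gen {..<n} (weyl_relators A)) ys"])
        (auto simp: foldr_gens weyl_gens_def)
  qed
  then show ?thesis by (simp add: word_length_def weyl_length_def gen_length_def)
qed

lemma reduced_word:
  assumes "valid xs"
  obtains ys where "valid ys" "weyl_elt A ys = weyl_elt A xs" "length ys = word_length A xs"
proof -
  have "\<exists>ys. valid ys \<and> length ys = word_length A xs \<and> weyl_elt A ys = weyl_elt A xs"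
    unfolding word_length_Least by (rule LeastI_ex) (use assms in blast)
  then show ?thesis using that by blast
qed

lemma word_length_le: "valid ys \<Longrightarrow> weyl_elt A ys = weyl_elt A xs \<Longrightarrow> word_length A xs \<le> length ys"
  unfolding word_length_Least by (rule Least_le) blast

lemma word_length_cong: "weyl_elt A ys = weyl_elt A xs \<Longrightarrow> word_length A ys = word_length A xs"
  by (simp add: word_length_def)

lemma word_length_append:
  assumes "valid xs" "valid ys"
  shows "word_length A (xs @ ys) \<le> word_length A xs + length ys"
proof -
  obtain zs where "valid zs" "weyl_elt A zs = weyl_elt A xs" "length zs = word_length A xs"
    using reduced_word[OF assms(1)] .
  then show ?thesis
    using word_length_le[of "zs @ ys" "xs @ ys"] elt_append[of zs xs ys ys] assms by simp
qed

lemma word_length_even: "valid xs \<Longrightarrow> even (word_length A xs) \<longleftrightarrow> even (length xs)"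
  by (metis elt_even reduced_word)

lemma word_length_snoc:
  assumes "valid xs" "i < n"
  shows "word_length A (xs @ [i]) = Suc (word_length A xs) \<or>
    word_length A xs = Suc (word_length A (xs @ [i]))"
proof -
  have "word_length A (xs @ [i]) \<le> word_length A xs + 1"
    using word_length_append[of xs "[i]"] assms by simp
  moreover have "word_length A xs \<le> word_length A (xs @ [i]) + 1"
    using word_length_append[of "xs @ [i]" "[i]"] word_length_cong[OF elt_cancel[of i xs "[]"]] assms
    by simp
  moreover have "even (word_length A (xs @ [i])) \<longleftrightarrow> odd (word_length A xs)"
    using assms by (simp add: word_length_even)
  ultimately show ?thesis by (cases "word_length A (xs @ [i]) = word_length A xs") auto
qed

lemma word_length_0_iff: "valid xs \<Longrightarrow> word_length A xs = 0 \<longleftrightarrow> weyl_elt A xs = weyl_elt A []"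
  by (metis bot_least empty_set le_zero_eq length_0_conv reduced_word word_length_le)

end

section \<open>Lengthening and positive roots\<close>

text \<open>
  The alternating word of length \<open>k\<close> in \<open>s\<close> and \<open>t\<close> that ends in \<open>t\<close>. It grows at the front, since
  it is the word acting on \<open>simple_root s\<close> from the left.
\<close>

primrec alternate :: "nat \<Rightarrow> 'a \<Rightarrow> 'a \<Rightarrow> 'a list" where
  "alternate 0 s t = []"
| "alternate (Suc k) s t = (if even k then t else s) # alternate k s t"

lemma length_alternate [simp]: "length (alternate k s t) = k"
  by (induction k) auto

lemma set_alternate: "set (alternate k s t) \<subseteq> {s, t}"
  by (induction k) auto

lemma alternate_snoc: "alternate k s t @ [s] = alternate (Suc k) t s"
  by (induction k) auto

lemma alternate_double: "alternate (2 * m) t s = concat (replicate m [t, s])"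
  by (induction m) auto

lemma alternate_suffix: "\<exists>u. alternate (j + k) s t = u @ alternate k s t \<and> length u = j \<and> set u \<subseteq> {s, t}"
proof (induction j)
  case (Suc j)
  then obtain u where "alternate (j + k) s t = u @ alternate k s t" "length u = j" "set u \<subseteq> {s, t}"
    by blast
  then show ?case by (intro exI[of _ "(if even (j + k) then t else s) # u"]) auto
qed simp

text \<open>
  The coordinates \<open>(p, q)\<close> of the image of \<open>simple_root s\<close> under \<open>alternate k s t\<close> with respect to
  the roots of \<open>s\<close> and \<open>t\<close>, where \<open>a\<close> and \<open>b\<close> are the entries of the Cartan matrix at \<open>(s, t)\<close> and
  \<open>(t, s)\<close>.
\<close>

primrec plane_coords :: "int \<Rightarrow> int \<Rightarrow> nat \<Rightarrow> int \<times> int" where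
  "plane_coords a b 0 = (1, 0)"
| "plane_coords a b (Suc k) = (let (p, q) = plane_coords a b k in
     if even k then (p, - b * p - q) else (- a * q - p, q))"

text \<open>
  The last step has replaced, say, \<open>p\<close> by \<open>- a q - p\<close>. The inequality in the claim says that this
  left at least half of \<open>- a q\<close>, and \<open>a b \<ge> 4\<close> is what the next step needs to reproduce it with the
  coordinates exchanged.
\<close>

lemma plane_coords_infinite:
  assumes "a \<le> 0" "b \<le> 0" "4 \<le> a * b" "plane_coords a b k = (p, q)"
  shows "0 \<le> p \<and> 0 \<le> q \<and> (if even k then - a * q \<le> 2 * p else - b * p \<le> 2 * q)"
  using assms(4)
proof (induction k arbitrary: p q)
  case (Suc k)
  obtain p' q' where pq: "plane_coords a b k = (p', q')" by force
  have IH: "0 \<le> p'" "0 \<le> q'" "if even k then - a * q' \<le> 2 * p' else - b * p' \<le> 2 * q'"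
    using Suc.IH[OF pq] by auto
  have *: "2 * x \<le> - d * y"
    if "0 \<le> x" "- c * x \<le> 2 * y" "c \<le> 0" "d \<le> 0" "4 \<le> c * d" for c d x y :: int
  proof -
    have "4 * x \<le> (c * d) * x" using that by (intro mult_right_mono)
    also have "\<dots> = - d * (- c * x)" by simp
    also have "\<dots> \<le> - d * (2 * y)" using that by (intro mult_left_mono) auto
    finally show ?thesis by simp
  qed
  show ?case
  proof (cases "even k")
    case True
    then have "p = p'" "q = - b * p' - q'" using Suc.prems pq by auto
    then show ?thesis using *[of q' a p' b] IH True assms by auto
  next
    case False
    then have "q = q'" "p = - a * q' - p'" using Suc.prems pq by auto
    then show ?thesis using *[of p' b q' a] IH False assms by (auto simp: mult.commute)
  qed
qed simp

lemma plane_coords_small: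
  fixes a b :: int
  defines "c \<equiv> a * b"
  shows "plane_coords a b 1 = (1, - b)"
    and "plane_coords a b 2 = (c - 1, - b)"
    and "plane_coords a b 3 = (c - 1, - b * (c - 2))"
    and "plane_coords a b 4 = (c * (c - 2) - (c - 1), - b * (c - 2))"
    and "plane_coords a b 5 = (c * (c - 2) - (c - 1), - b * ((c - 1) * (c - 3)))"
proof -
  show 1: "plane_coords a b 1 = (1, - b)" by simp
  show 2: "plane_coords a b 2 = (c - 1, - b)"
    using plane_coords.simps(2)[of a b 1] by (simp only: 1 Suc_1) (simp add: c_def)
  have s: "Suc 2 = 3" "Suc 3 = 4" "Suc 4 = 5" by simp_all
  show 3: "plane_coords a b 3 = (c - 1, - b * (c - 2))"
    using plane_coords.simps(2)[of a b 2] by (simp only: 2 s) (simp add: algebra_simps)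
  show 4: "plane_coords a b 4 = (c * (c - 2) - (c - 1), - b * (c - 2))"
    using plane_coords.simps(2)[of a b 3] by (simp only: 3 s) (simp add: c_def algebra_simps)
  show 5: "plane_coords a b 5 = (c * (c - 2) - (c - 1), - b * ((c - 1) * (c - 3)))"
    using plane_coords.simps(2)[of a b 4] by (simp only: 4 s) (simp add: algebra_simps)
qed

context cartan
begin

lemma product_infinite:
  assumes "i < n" "j < n" "i \<noteq> j" "coxeter_exponent A i j = \<infinity>"
  shows "4 \<le> A $$ (i, j) * A $$ (j, i)"
proof -
  have "0 \<le> A $$ (i, j) * A $$ (j, i)"
    using off_diag assms by (intro mult_nonpos_nonpos) auto
  moreover have "A $$ (i, j) * A $$ (j, i) \<notin> {0, 1, 2, 3}"
    using assms(4) by (auto simp: coxeter_exponent_def numeral_eq_enat split: if_splits)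
  ultimately show ?thesis by (simp only: insert_iff empty_iff) linarith
qed

text \<open>
  The dihedral case of the length criterion. For a finite exponent \<open>m\<close> the bound \<open>k < m\<close> stops
  just before the root turns negative.
\<close>

lemma plane_coords_nonneg:
  assumes "s < n" "t < n" "s \<noteq> t" "enat k < coxeter_exponent A s t"
    "plane_coords (A $$ (s, t)) (A $$ (t, s)) k = (p, q)"
  shows "0 \<le> p \<and> 0 \<le> q"
proof (cases "coxeter_exponent A s t")
  case infinity
  then show ?thesis
    using plane_coords_infinite[OF _ _ product_infinite[OF assms(1-3) infinity] assms(5)]
      off_diag assms by auto
next
  case (enat m)
  have "k < m" using assms(4) enat by simp
  moreover have "m \<le> 6"
    using exponent_cases[OF assms(1-3) enat] by auto
  ultimately have k: "k \<in> {0, 1, 2, 3, 4, 5}" by auto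
  have "(A $$ (s, t), A $$ (t, s), m) \<in>
    {(0, 0, 2), (-1, -1, 3), (-1, -2, 4), (-2, -1, 4), (-1, -3, 6), (-3, -1, 6)}"
    by (rule exponent_cases[OF assms(1-3) enat])
  then show ?thesis
    using k \<open>k < m\<close> assms(5)
    by (elim insertE emptyE; simp only: prod.inject; elim conjE; hypsubst_thin)
      (auto simp: plane_coords_small simp del: plane_coords.simps(2) One_nat_def)
qed

lemma act_alternate:
  assumes "s < n" "t < n" "plane_coords (A $$ (s, t)) (A $$ (t, s)) k = (p, q)"
  shows "act A (alternate k s t) (simple_root s) = (\<lambda>l. p * simple_root s l + q * simple_root t l)"
  using assms(3)
proof (induction k arbitrary: p q)
  case (Suc k)
  obtain p' q' where pq: "plane_coords (A $$ (s, t)) (A $$ (t, s)) k = (p', q')" by force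
  have pairing_0: "pairing A i (\<lambda>k. 0) = 0" for i by (simp add: pairing_def)
  have *: "reflect A s (\<lambda>l. p' * simple_root s l + q' * simple_root t l) =
      (\<lambda>l. (- A $$ (s, t) * q' - p') * simple_root s l + q' * simple_root t l)"
    "reflect A t (\<lambda>l. p' * simple_root s l + q' * simple_root t l) =
      (\<lambda>l. p' * simple_root s l + (- A $$ (t, s) * p' - q') * simple_root t l)"
    using reflect_plane[OF assms(1,2), of "\<lambda>_. 0" p' q']
      reflect_plane'[OF assms(1,2), of "\<lambda>_. 0" p' q']
    by (simp_all add: pairing_0 algebra_simps)
  show ?case
  proof (cases "even k")
    case True
    then have "p = p'" "q = - A $$ (t, s) * p' - q'" using Suc.prems pq by auto
    then show ?thesis using True by (simp only: alternate.simps if_True act_Cons Suc.IH[OF pq] *)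
  next
    case False
    then have "q = q'" "p = - A $$ (s, t) * q' - p'" using Suc.prems pq by auto
    then show ?thesis using False by (simp only: alternate.simps if_False act_Cons Suc.IH[OF pq] *)
  qed
qed simp

text \<open>
  An alternating word of length \<open>m + 1\<close> is a suffix of one of length \<open>2 m\<close>, which is trivial, so it
  equals the inverse of the remaining \<open>m - 1\<close> letters.
\<close>

lemma alternate_not_reduced:
  assumes "s < n" "t < n" "s \<noteq> t" "coxeter_exponent A s t = enat m"
  shows "\<exists>u. valid u \<and> length u < m \<and> weyl_elt A (alternate m s t @ [s]) = weyl_elt A u"
proof -
  have m: "2 \<le> m" using exponent_cases[OF assms] by auto
  obtain u where u: "alternate ((m - 1) + Suc m) t s = u @ alternate (Suc m) t s"
    "length u = m - 1" "set u \<subseteq> {t, s}"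
    using alternate_suffix by metis
  have v: "valid u" "valid (alternate (Suc m) t s)"
    using u(3) set_alternate[of "Suc m" t s] assms by auto
  have "(m - 1) + Suc m = 2 * m" using m by simp
  moreover have "weyl_elt A (alternate (2 * m) t s) = weyl_elt A []"
  proof -
    have "coxeter_exponent A t s = enat m"
      using assms(4) by (simp add: coxeter_exponent_def mult.commute)
    then show ?thesis
      unfolding alternate_double using assms by (intro elt_braid) auto
  qed
  ultimately have "weyl_elt A (u @ alternate (Suc m) t s) = weyl_elt A []"
    using u(1) by metis
  moreover have "weyl_elt A (u @ rev u) = weyl_elt A []"
    by (rule elt_rev'[OF v(1)])
  ultimately have "weyl_elt A (alternate (Suc m) t s) = weyl_elt A (rev u)"
    by (intro elt_cancel_left[OF _ v(1,2)]) (use v in auto)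
  then show ?thesis
    using u m v by (intro exI[of _ "rev u"]) (auto simp only: alternate_snoc set_rev length_rev)
qed

text \<open>
  The length criterion. If \<open>w = xs\<close> is not trivial, it has a descent \<open>t \<noteq> s\<close>, and \<open>w\<close> is split as
  \<open>v\<close> times an alternating word in \<open>s, t\<close> with lengths adding up and that word as long as possible.
  Then \<open>v\<close> is shorter than \<open>w\<close> and has neither \<open>s\<close> nor \<open>t\<close> as a descent, so by induction it sends
  both roots to nonnegative vectors, while the alternating word sends the root of \<open>s\<close> to a
  nonnegative combination of these two by the dihedral computation.
\<close>

lemma ascent_root_nonneg:
  assumes "valid xs" "s < n" "word_length A xs < word_length A (xs @ [s])"
  shows "0 \<le> act A xs (simple_root s) l"
  using assms
proof (induction "word_length A xs" arbitrary: xs s l rule: less_induct)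
  case (less xs s)
  note val = less.prems(1) and s = less.prems(2) and asc = less.prems(3)
  show ?case
  proof (cases "word_length A xs = 0")
    case True
    then have "act A xs = act A []"
      using val by (intro elt_act) (auto simp: word_length_0_iff)
    then show ?thesis by (simp add: simple_root_def)
  next
    case False
    obtain ys where ys: "valid ys" "weyl_elt A ys = weyl_elt A xs" "length ys = word_length A xs"
      using reduced_word[OF val] .
    obtain zs t where zs: "ys = zs @ [t]"
      using False ys(3) by (cases ys rule: rev_cases) auto
    have t: "t < n" and vzs: "valid zs" using ys(1) zs by auto
    have zst: "weyl_elt A (zs @ [t]) = weyl_elt A xs" using ys(2) zs by simp
    have lzs: "Suc (word_length A zs) = word_length A xs"
    proof -
      have "word_length A zs \<le> length zs" using word_length_le[OF vzs HOL.refl] .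
      moreover have "word_length A (zs @ [t]) = word_length A xs" by (rule word_length_cong[OF zst])
      ultimately show ?thesis
        using word_length_append[OF vzs, of "[t]"] t ys(3) zs by simp
    qed
    have st: "s \<noteq> t"
    proof
      assume "s = t"
      then have "weyl_elt A (xs @ [s]) = weyl_elt A zs"
        using elt_append[OF zst HOL.refl[of "weyl_elt A [t]"]] elt_cancel[OF t vzs, of "[]"] t val vzs
        by simp
      then show False using word_length_cong[of "xs @ [s]" zs] lzs asc by simp
    qed
    define P where "P k v \<longleftrightarrow> valid v \<and> weyl_elt A (v @ alternate k s t) = weyl_elt A xs \<and>
      word_length A v + k = word_length A xs" for k v
    have "P 1 zs" unfolding P_def using vzs zst lzs by simp
    define k where "k = (GREATEST k. \<exists>v. P k v)"
    have bound: "\<And>k. \<exists>v. P k v \<Longrightarrow> k \<le> word_length A xs" unfolding P_def by auto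
    have "\<exists>v. P k v"
      unfolding k_def by (rule GreatestI_nat[where b = "word_length A xs"]) (use \<open>P 1 zs\<close> bound in blast)+
    then obtain v where v: "P k v" by blast
    have max: "j \<le> k" if "P j u" for j u
      unfolding k_def by (rule Greatest_le_nat[where b = "word_length A xs"]) (use that bound in blast)+
    have "1 \<le> k" using max[OF \<open>P 1 zs\<close>] .
    then obtain k' where k': "k = Suc k'" by (cases k) auto
    have vv: "valid v" and vel: "weyl_elt A (v @ alternate k s t) = weyl_elt A xs"
      and vlen: "word_length A v + k = word_length A xs"
      using v unfolding P_def by auto
    have valt: "valid (alternate j s t)" for j using set_alternate[of j s t] s t by auto
    \<comment> \<open>\<open>y\<close> is the first letter of the alternating word, \<open>x\<close> the letter that would extend it.\<close>
    define y x where "y = (if even k' then t else s)" and "x = (if even k then t else s)"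
    have yx: "y < n" "x < n" using s t by (auto simp: x_def y_def)
    have asc_y: "word_length A v < word_length A (v @ [y])"
    proof -
      have "word_length A xs = word_length A ((v @ [y]) @ alternate k' s t)"
        using word_length_cong[OF vel] by (simp add: k' y_def)
      also have "\<dots> \<le> word_length A (v @ [y]) + k'"
        using word_length_append[of "v @ [y]" "alternate k' s t"] vv yx valt by simp
      finally show ?thesis using vlen k' by simp
    qed
    have asc_x: "word_length A v < word_length A (v @ [x])"
    proof (rule ccontr)
      assume "\<not> ?thesis"
      then have "word_length A v = Suc (word_length A (v @ [x]))"
        using word_length_snoc[OF vv yx(2)] by auto
      moreover have "weyl_elt A ((v @ [x]) @ alternate (Suc k) s t) = weyl_elt A xs"
        using elt_cancel[OF yx(2) vv valt] vel by (simp add: x_def)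
      ultimately have "P (Suc k) (v @ [x])"
        unfolding P_def using vv yx vlen by auto
      then show False using max by fastforce
    qed
    have "{x, y} = {s, t}" by (auto simp: x_def y_def k')
    then have asc_st: "word_length A v < word_length A (v @ [s])" "word_length A v < word_length A (v @ [t])"
      using asc_x asc_y by (metis insertCI insertE singletonD)+
    have "enat k < coxeter_exponent A s t"
    proof (rule ccontr)
      assume "\<not> ?thesis"
      then obtain m where m: "coxeter_exponent A s t = enat m" "m \<le> k"
        by (cases "coxeter_exponent A s t") auto
      obtain u where u: "alternate ((k - m) + m) s t = u @ alternate m s t" "length u = k - m" "set u \<subseteq> {s, t}"
        using alternate_suffix by metis
      have vu: "valid u" using u(3) s t by auto
      obtain w where w: "valid w" "length w < m" "weyl_elt A (alternate m s t @ [s]) = weyl_elt A w"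
        using alternate_not_reduced[OF s t st m(1)] by blast
      have "weyl_elt A (xs @ [s]) = weyl_elt A ((v @ alternate k s t) @ [s])"
        by (rule elt_append[OF vel[symmetric] HOL.refl]) (use val vv valt s in auto)
      also have "\<dots> = weyl_elt A ((v @ u) @ (alternate m s t @ [s]))"
        using u(1) m(2) by simp
      also have "\<dots> = weyl_elt A ((v @ u) @ w)"
        by (rule elt_append[OF HOL.refl w(3)]) (use vv vu valt s w in auto)
      finally have "word_length A (xs @ [s]) = word_length A (v @ (u @ w))"
        by (intro word_length_cong) simp
      also have "\<dots> \<le> word_length A v + (length u + length w)"
        using word_length_append[of v "u @ w"] vv vu w by simp
      finally show False using asc u w vlen m by simp
    qed
    then obtain p q where pq: "plane_coords (A $$ (s, t)) (A $$ (t, s)) k = (p, q)" "0 \<le> p" "0 \<le> q"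
      using plane_coords_nonneg[OF s t st] by (metis surj_pair)
    have "act A xs = act A (v @ alternate k s t)"
      by (rule elt_act[OF vel[symmetric]]) (use val vv valt in auto)
    then have "act A xs (simple_root s) = act A v (\<lambda>l. p * simple_root s l + q * simple_root t l)"
      using act_alternate[OF s t pq(1)] by (simp add: act_append)
    then have "act A xs (simple_root s) l = p * act A v (simple_root s) l + q * act A v (simple_root t) l"
      by (simp add: act_comb)
    moreover have "word_length A v < word_length A xs" using vlen k' by simp
    ultimately show ?thesis
      using less.hyps[OF _ vv s asc_st(1)] less.hyps[OF _ vv t asc_st(2)] pq by simp
  qed
qed

end

section \<open>Longest elements and finite type\<close>

lemma gram_positive_definite:
  fixes c :: "'p \<Rightarrow> nat \<Rightarrow> real"
  assumes "finite P" "M \<in> carrier_mat n n"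
    and M: "\<And>i j. i < n \<Longrightarrow> j < n \<Longrightarrow> M $$ (i, j) = (\<Sum>p\<in>P. c p i * c p j)"
    and unit: "\<And>k. k < n \<Longrightarrow> \<exists>p\<in>P. \<forall>i<n. c p i = (if i = k then 1 else 0)"
  shows "positive_definite M"
  unfolding positive_definite_def
proof (intro exI[of _ n] conjI ballI impI)
  show "transpose_mat M = M"
    using assms(2) by (intro eq_matI) (auto simp: M mult.commute)
  fix x :: "real vec"
  assume x: "x \<in> carrier_vec n" "x \<noteq> 0\<^sub>v n"
  then obtain k where k: "k < n" "x $ k \<noteq> 0" by (auto simp: vec_eq_iff)
  obtain p where p: "p \<in> P" "\<forall>i<n. c p i = (if i = k then 1 else 0)" using unit[OF k(1)] by blast
  have "scalar_prod x (M *\<^sub>v x) = (\<Sum>i<n. x $ i * (\<Sum>j<n. M $$ (i, j) * x $ j))"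
    using x(1) assms(2) by (simp add: scalar_prod_def lessThan_atLeast0)
  also have "\<dots> = (\<Sum>i<n. \<Sum>j<n. \<Sum>p\<in>P. (x $ i * c p i) * (x $ j * c p j))"
    by (intro sum.cong HOL.refl) (simp add: M sum_distrib_left sum_distrib_right mult_ac)
  also have "\<dots> = (\<Sum>i<n. \<Sum>p\<in>P. \<Sum>j<n. (x $ i * c p i) * (x $ j * c p j))"
    by (intro sum.cong HOL.refl sum.swap)
  also have "\<dots> = (\<Sum>p\<in>P. \<Sum>i<n. \<Sum>j<n. (x $ i * c p i) * (x $ j * c p j))"
    by (rule sum.swap)
  also have "\<dots> = (\<Sum>p\<in>P. (\<Sum>i<n. x $ i * c p i)\<^sup>2)"
    by (simp add: power2_eq_square sum_product)
  also have "\<dots> > 0"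
  proof (rule sum_pos2[OF assms(1) p(1)])
    have "(\<Sum>i<n. x $ i * c p i) = (\<Sum>i<n. if i = k then x $ i else 0)"
      using p(2) by (intro sum.cong) auto
    also have "\<dots> = x $ k" using k(1) by simp
    finally show "0 < (\<Sum>i<n. x $ i * c p i)\<^sup>2" using k(2) by simp
  qed simp
  finally show "0 < scalar_prod x (M *\<^sub>v x)" .
qed (fact assms(2))

lemma act_zero: "act A xs (\<lambda>_. 0) = (\<lambda>_. 0)"
  using act_sum[of A xs _ _ "{}"] by simp

lemma act_neg: "act A xs (\<lambda>k. - x k) = (\<lambda>k. - act A xs x k)"
  using act_comb[of A xs "-1" x 0 x] by simp

context cartan
begin

lemma act_rev: "valid xs \<Longrightarrow> act A (rev xs) (act A xs x) = x"
  using elt_act[OF elt_rev, of xs] by (simp add: act_append[symmetric])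

lemma root_nonzero:
  assumes "valid xs"
  shows "act A xs (simple_root i) \<noteq> (\<lambda>_. 0)"
proof
  assume "act A xs (simple_root i) = (\<lambda>_. 0)"
  then have "simple_root i = (\<lambda>_. 0)"
    using act_rev[OF assms, of "simple_root i"] by (simp add: act_zero)
  then have "simple_root i i = 0" by simp
  then show False by (simp add: simple_root_def)
qed

lemma reflect_own_root: "i < n \<Longrightarrow> reflect A i (simple_root i) = (\<lambda>k. - simple_root i k)"
  by (auto simp: reflect_def pairing_root diag)

lemma descent_root_nonpos:
  assumes "valid xs" "i < n" "word_length A (xs @ [i]) < word_length A xs"
  shows "act A xs (simple_root i) l \<le> 0"
proof -
  have "word_length A ((xs @ [i]) @ [i]) = word_length A xs"
    using elt_cancel[of i xs "[]"] assms by (intro word_length_cong) simp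
  then have "0 \<le> act A (xs @ [i]) (simple_root i) l"
    using assms by (intro ascent_root_nonneg) auto
  then show ?thesis using assms by (simp add: act_append reflect_own_root act_neg)
qed

lemma
  assumes "valid xs" "i < n"
  shows ascent_iff: "word_length A xs < word_length A (xs @ [i]) \<longleftrightarrow>
      (\<forall>l. 0 \<le> act A xs (simple_root i) l)" (is ?asc)
    and descent_iff: "word_length A (xs @ [i]) < word_length A xs \<longleftrightarrow>
      (\<forall>l. act A xs (simple_root i) l \<le> 0)" (is ?desc)
proof -
  have "\<not> ((\<forall>l. 0 \<le> act A xs (simple_root i) l) \<and> (\<forall>l. act A xs (simple_root i) l \<le> 0))"
  proof
    assume "(\<forall>l. 0 \<le> act A xs (simple_root i) l) \<and> (\<forall>l. act A xs (simple_root i) l \<le> 0)"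
    then have "act A xs (simple_root i) = (\<lambda>_. 0)" by (intro ext antisym) auto
    then show False using root_nonzero[OF assms(1)] by blast
  qed
  moreover have "word_length A xs < word_length A (xs @ [i]) \<or>
    word_length A (xs @ [i]) < word_length A xs"
    using word_length_snoc[OF assms] by auto
  ultimately show ?asc ?desc
    using ascent_root_nonneg[OF assms] descent_root_nonpos[OF assms] by blast+
qed

lemma ascent_length:
  assumes "valid xs" "i < n" "\<And>l. 0 \<le> act A xs (simple_root i) l"
  shows "word_length A (xs @ [i]) = Suc (word_length A xs)"
proof -
  have "word_length A xs < word_length A (xs @ [i])" using assms by (simp add: ascent_iff)
  then show ?thesis using word_length_snoc[OF assms(1,2)] by auto
qed

lemma reduced_snoc:
  assumes "valid (xs @ [i])" "word_length A (xs @ [i]) = length (xs @ [i])"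
  shows "word_length A xs = length xs" "\<And>l. 0 \<le> act A xs (simple_root i) l"
proof -
  have *: "valid xs" "i < n" using assms by auto
  have "word_length A xs \<le> length xs" using word_length_le[OF *(1) HOL.refl] .
  then show 1: "word_length A xs = length xs" using word_length_snoc[OF *] assms(2) by auto
  show "0 \<le> act A xs (simple_root i) l" for l
    by (rule ascent_root_nonneg[OF *]) (use 1 assms(2) in simp)
qed

lemma act_outside: "valid xs \<Longrightarrow> k \<ge> n \<Longrightarrow> act A xs x k = x k"
  by (induction xs) (auto simp: reflect_def simple_root_def)

lemma act_act_root:
  assumes "valid ys" "i < n"
  shows "act A xs (act A ys (simple_root i)) l =
    (\<Sum>j<n. act A ys (simple_root i) j * act A xs (simple_root j) l)"
proof -
  have "act A ys (simple_root i) = (\<lambda>k. \<Sum>j<n. act A ys (simple_root i) j * simple_root j k)"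
  proof
    fix k
    show "act A ys (simple_root i) k = (\<Sum>j<n. act A ys (simple_root i) j * simple_root j k)"
    proof (cases "k < n")
      case True
      then show ?thesis by (simp add: simple_root_def if_distrib cong: if_cong)
    next
      case False
      then show ?thesis using assms act_outside[of ys k] by (simp add: simple_root_def)
    qed
  qed
  then have "act A xs (act A ys (simple_root i)) =
    act A xs (\<lambda>k. \<Sum>j<n. act A ys (simple_root i) j * simple_root j k)" by simp
  then show ?thesis by (simp add: act_sum)
qed

text \<open>
  If \<open>w = xs\<close> sends all simple roots to nonpositive vectors, then along a reduced word \<open>ys\<close> each new
  letter has a root that \<open>ys\<close> makes nonnegative and hence \<open>w\<close> makes nonpositive again; so every
  letter of \<open>ys\<close> shortens \<open>w\<close>, and no reduced word can be longer than \<open>w\<close>.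
\<close>

lemma longest_word:
  assumes "valid xs" and desc: "\<And>i. i < n \<Longrightarrow> word_length A (xs @ [i]) < word_length A xs"
    and "valid ys" "word_length A ys = length ys"
  shows "word_length A (xs @ ys) + length ys = word_length A xs"
  using assms(3,4)
proof (induction ys rule: rev_induct)
  case (snoc i ys)
  have v: "valid ys" "i < n" using snoc.prems by auto
  have *: "act A xs (simple_root j) l \<le> 0" if "j < n" for j l
    by (rule descent_root_nonpos[OF assms(1) that desc[OF that]])
  have "act A (xs @ ys) (simple_root i) l \<le> 0" for l
    unfolding act_append act_act_root[OF v]
    using * reduced_snoc(2)[OF snoc.prems] by (intro sum_nonpos mult_nonneg_nonpos) auto
  then have "word_length A ((xs @ ys) @ [i]) < word_length A (xs @ ys)"
    using descent_iff[of "xs @ ys" i] v assms(1) by simp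
  then have "word_length A (xs @ ys) = Suc (word_length A ((xs @ ys) @ [i]))"
    using word_length_snoc[of "xs @ ys" i] v assms(1) by auto
  then show ?case using snoc.IH[OF v(1) reduced_snoc(1)[OF snoc.prems]] by simp
qed simp

lemma finite_if_all_descents:
  assumes "valid xs" "\<And>i. i < n \<Longrightarrow> word_length A (xs @ [i]) < word_length A xs"
  shows "finite (carrier (weyl_group A))"
proof (rule finite_subset)
  show "carrier (weyl_group A) \<subseteq>
    (\<Union>k\<le>word_length A xs. {w \<in> carrier (weyl_group A). weyl_length A w = k})"
  proof
    fix w assume w: "w \<in> carrier (weyl_group A)"
    obtain ys where ys: "valid ys" "weyl_elt A ys = w" using carrier_word[OF w] by blast
    obtain zs where zs: "valid zs" "weyl_elt A zs = weyl_elt A ys" "length zs = word_length A ys"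
      using reduced_word[OF ys(1)] .
    have "word_length A zs = length zs" using word_length_cong[OF zs(2)] zs(3) by simp
    then have "length zs \<le> word_length A xs" using longest_word[OF assms zs(1)] by simp
    then have "weyl_length A w \<le> word_length A xs"
      using zs(3) ys(2) by (simp add: word_length_def)
    then show "w \<in> (\<Union>k\<le>word_length A xs. {w \<in> carrier (weyl_group A). weyl_length A w = k})"
      using w by simp
  qed
qed (simp add: finite_weyl_length)

text \<open>
  Averaging over a finite Weyl group gives an invariant inner product \<open>B\<close>. A reflection that
  preserves \<open>B\<close> is orthogonal, hence \<open>a\<^sub>i\<^sub>j = 2 B(\<alpha>\<^sub>i, \<alpha>\<^sub>j) / B(\<alpha>\<^sub>i, \<alpha>\<^sub>i)\<close>. So the factors
  \<open>B(\<alpha>\<^sub>i, \<alpha>\<^sub>i) / 2\<close> turn the Cartan matrix into the Gram matrix of the simple roots.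
\<close>

lemma finite_imp_finite_type:
  assumes fin: "finite (carrier (weyl_group A))"
  shows "finite_type A"
proof -
  let ?C = "carrier (weyl_group A)"
  define B where "B x y = (\<Sum>w\<in>?C. \<Sum>k<n. act A (weyl_word A w) x k * act A (weyl_word A w) y k)" for x y
  define r where "r i w = w \<otimes>\<^bsub>weyl_group A\<^esub> weyl_elt A [i]" for i w
  have r: "r i w \<in> ?C" "act A (weyl_word A (r i w)) x = act A (weyl_word A w) (reflect A i x)" "r i (r i w) = w"
    if i: "i < n" and w: "w \<in> ?C" for i w x
  proof -
    have e: "r i w = weyl_elt A (weyl_word A w @ [i])"
      using elt_mult[of "weyl_word A w" "[i]"] weyl_word[OF w] i by (simp add: r_def)
    then show C: "r i w \<in> ?C" using elt_carrier[of "weyl_word A w @ [i]"] weyl_word[OF w] i by simp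
    have "act A (weyl_word A (r i w)) = act A (weyl_word A w @ [i])"
      using weyl_word[OF C] weyl_word[OF w] i e by (intro elt_act) auto
    then show "act A (weyl_word A (r i w)) x = act A (weyl_word A w) (reflect A i x)" by (simp add: act_append)
    have "r i (r i w) = weyl_elt A (weyl_word A w @ [i, i])"
      using elt_mult[of "weyl_word A w @ [i]" "[i]"] weyl_word[OF w] i by (subst r_def) (simp add: e)
    then show "r i (r i w) = w" using elt_cancel[of i "weyl_word A w" "[]"] weyl_word[OF w] i by simp
  qed
  have inv: "B (reflect A i x) (reflect A i y) = B x y" if "i < n" for i x y
    unfolding B_def
    by (rule sum.reindex_bij_witness[of _ "r i" "r i"]) (simp_all add: r that)
  have gram: "2 * B (simple_root i) (simple_root j) =
      A $$ (i, j) * B (simple_root i) (simple_root i)" if ij: "i < n" "j < n" for i j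
  proof -
    have "reflect A i (simple_root j) = (\<lambda>k. 1 * simple_root j k + (- A $$ (i, j)) * simple_root i k)"
      using ij by (auto simp: reflect_def pairing_root)
    then have "B (reflect A i (simple_root i)) (reflect A i (simple_root j)) =
      (\<Sum>w\<in>?C. \<Sum>k<n. (- act A (weyl_word A w) (simple_root i) k) *
        (act A (weyl_word A w) (simple_root j) k - A $$ (i, j) * act A (weyl_word A w) (simple_root i) k))"
      unfolding B_def reflect_own_root[OF ij(1)] by (simp only: act_neg act_comb) simp
    also have "\<dots> = A $$ (i, j) * B (simple_root i) (simple_root i) - B (simple_root i) (simple_root j)"
      by (simp add: B_def algebra_simps sum_distrib_left sum.distrib sum_subtractf sum_negf)
    finally show ?thesis using inv[OF ij(1)] by simp
  qed
  define c where "c p i = real_of_int (act A (weyl_word A (fst p)) (simple_root i) (snd p))" for p i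
  have B_c: "real_of_int (B (simple_root i) (simple_root j)) = (\<Sum>p\<in>?C \<times> {..<n}. c p i * c p j)" for i j
    unfolding B_def c_def by (simp add: sum.cartesian_product case_prod_beta)
  have one: "weyl_elt A [] \<in> ?C" by (rule elt_carrier) simp
  have act_one: "act A (weyl_word A (weyl_elt A [])) x = x" for x
    using elt_act[of "weyl_word A (weyl_elt A [])" "[]"] weyl_word[OF one] by simp
  have unit: "\<exists>p\<in>?C \<times> {..<n}. \<forall>i<n. c p i = (if i = k then 1 else 0)" if "k < n" for k
    using one that by (intro bexI[of _ "(weyl_elt A [], k)"]) (auto simp: c_def act_one simple_root_def)
  define d where "d i = real_of_int (B (simple_root i) (simple_root i)) / 2" for i
  have A: "A \<in> carrier_mat n n" using cartan unfolding cartan_matrix_def by blast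
  then have "map_mat real_of_int A \<in> carrier_mat n n" unfolding map_carrier_mat .
  note M_eq = mat_diag_mult_left[OF this, of d]
  have M: "mat_diag n d * map_mat real_of_int A \<in> carrier_mat n n"
    unfolding M_eq by (rule mat_carrier)
  have col: "dim_col A = n" using A by (rule carrier_matD(2))
  have entry: "(mat_diag n d * map_mat real_of_int A) $$ (i, j) = (\<Sum>p\<in>?C \<times> {..<n}. c p i * c p j)"
    if ij: "i < n" "j < n" for i j
  proof -
    have "(mat_diag n d * map_mat real_of_int A) $$ (i, j) = d i * real_of_int (A $$ (i, j))"
      unfolding M_eq using ij by (simp add: col)
    also have "\<dots> = real_of_int (A $$ (i, j) * B (simple_root i) (simple_root i)) / 2"
      by (simp add: d_def)
    also have "\<dots> = real_of_int (B (simple_root i) (simple_root j))"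
      unfolding gram[OF ij, symmetric] by simp
    finally show ?thesis by (simp only: B_c)
  qed
  have "0 < d i" if i: "i < n" for i
  proof -
    obtain p where p: "p \<in> ?C \<times> {..<n}" "c p i = 1" using unit[OF i] i by auto
    have "0 < (\<Sum>p\<in>?C \<times> {..<n}. c p i * c p i)"
      by (rule sum_pos2[OF _ p(1)]) (use fin p in auto)
    then show ?thesis by (simp add: d_def B_c)
  qed
  moreover have "positive_definite (mat_diag n d * map_mat real_of_int A)"
    by (rule gram_positive_definite[OF _ M entry unit]) (simp_all add: fin)
  ultimately show ?thesis unfolding finite_type_def by blast
qed

end

section \<open>Growth series\<close>

definition growth_series :: "'a set \<Rightarrow> ('a \<Rightarrow> nat) \<Rightarrow> int fps" where
  "growth_series X l = Abs_fps (\<lambda>k. int (card {x \<in> X. l x = k}))"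

lemma growth_series_bij:
  assumes "bij_betw h X Y" "\<And>x. x \<in> X \<Longrightarrow> l' (h x) = l x"
  shows "growth_series Y l' = growth_series X l"
proof -
  have "card {y \<in> Y. l' y = k} = card {x \<in> X. l x = k}" for k
  proof -
    have "{y \<in> Y. l' y = k} = h ` {x \<in> X. l x = k}"
      using assms by (auto simp: bij_betw_def)
    moreover have "inj_on h {x \<in> X. l x = k}"
      using assms(1) by (auto simp: bij_betw_def intro: inj_on_subset)
    ultimately show ?thesis by (simp add: card_image)
  qed
  then show ?thesis by (simp add: growth_series_def)
qed

lemma growth_series_times:
  assumes X: "\<And>k. finite {x \<in> X. l x = k}" and Y: "\<And>k. finite {y \<in> Y. l' y = k}"
  shows "growth_series (X \<times> Y) (\<lambda>(x, y). l x + l' y) = growth_series X l * growth_series Y l'"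
proof (rule fps_ext)
  fix k
  have "{p \<in> X \<times> Y. (\<lambda>(x, y). l x + l' y) p = k} =
    (\<Union>i\<in>{0..k}. {x \<in> X. l x = i} \<times> {y \<in> Y. l' y = k - i})" by auto
  moreover have "card (\<Union>i\<in>{0..k}. {x \<in> X. l x = i} \<times> {y \<in> Y. l' y = k - i}) =
    (\<Sum>i\<in>{0..k}. card ({x \<in> X. l x = i} \<times> {y \<in> Y. l' y = k - i}))"
    using X Y by (intro card_UN_disjoint) auto
  ultimately show "fps_nth (growth_series (X \<times> Y) (\<lambda>(x, y). l x + l' y)) k =
    fps_nth (growth_series X l * growth_series Y l') k"
    by (simp add: growth_series_def fps_mult_nth card_cartesian_product)
qed

lemma growth_series_finite:
  assumes "finite X"
  shows "\<exists>p. growth_series X l = fps_of_poly p"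
proof (intro exI fps_ext)
  fix k
  have "card {x \<in> X. l x = k} = 0" if "k > Max (l ` X)"
  proof -
    have "l x \<noteq> k" if "x \<in> X" for x
      using Max_ge[OF finite_imageI[OF assms] imageI[OF that], of l] \<open>k > Max (l ` X)\<close> by linarith
    then have "{x \<in> X. l x = k} = {}" by blast
    then show ?thesis by (simp only: card.empty)
  qed
  then show "fps_nth (growth_series X l) k =
    fps_nth (fps_of_poly (\<Sum>i\<le>Max (l ` X). monom (int (card {x \<in> X. l x = i})) i)) k"
    by (auto simp: growth_series_def coeff_sum)
qed

lemma poincare_growth: "poincare_series A = growth_series (carrier (weyl_group A)) (weyl_length A)"
  by (simp add: poincare_series_def growth_series_def)

section \<open>Parabolic subgroups\<close>

text \<open>
  Defined by lengths, these are the shortest elements of the left cosets of the subgroup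
  generated by the letters in \<open>J\<close>.
\<close>

definition min_coset_reps :: "int mat \<Rightarrow> nat set \<Rightarrow> nat word set set" where
  "min_coset_reps A J = {w \<in> carrier (weyl_group A).
     \<forall>i\<in>J. weyl_length A w < weyl_length A (w \<otimes>\<^bsub>weyl_group A\<^esub> weyl_elt A [i])}"

context cartan
begin

lemma elt_min_coset_reps:
  assumes "valid xs" "J \<subseteq> {..<n}"
  shows "weyl_elt A xs \<in> min_coset_reps A J \<longleftrightarrow>
    (\<forall>i\<in>J. word_length A xs < word_length A (xs @ [i]))"
proof -
  have "weyl_elt A xs \<otimes>\<^bsub>weyl_group A\<^esub> weyl_elt A [i] = weyl_elt A (xs @ [i])" if "i \<in> J" for i
    using that assms by (intro elt_mult) auto
  then show ?thesis using elt_carrier[OF assms(1)] by (simp add: min_coset_reps_def word_length_def)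
qed

lemma reduced_word_length:
  assumes "valid xs"
  obtains ys where "valid ys" "weyl_elt A ys = weyl_elt A xs" "word_length A ys = length ys"
    "length ys = word_length A xs"
  using reduced_word[OF assms] word_length_cong by metis

end

text \<open>
  The matrix \<open>B\<close> is a principal submatrix of \<open>A\<close>, up to the renaming \<open>f\<close> of indices. Both matrices
  have their own abstract Weyl group; that the smaller group embeds with its length function is
  part of what is proved.
\<close>

locale cartan_sub = cartan A + sub: cartan B for A B :: "int mat" +
  fixes f :: "nat \<Rightarrow> nat"
  assumes inj: "inj_on f {..<dim_row B}"
    and range: "\<And>i. i < dim_row B \<Longrightarrow> f i < dim_row A"
    and entry: "\<And>i j. i < dim_row B \<Longrightarrow> j < dim_row B \<Longrightarrow> B $$ (i, j) = A $$ (f i, f j)"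
begin

lemma valid_map: "sub.valid xs \<Longrightarrow> valid (map f xs)"
  using range by auto

lemma rel_map: "(u, v) \<in> sub.rel \<Longrightarrow> (map (apfst f) u, map (apfst f) v) \<in> rel"
proof (induction rule: word_rel.induct)
  have words: "map (apfst f) x \<in> words {..<n}" if "x \<in> words {..<dim_row B}"
    for x :: "nat word"
    using that range by (force simp: words_def)
  {
    case (refl u)
    then show ?case by (intro word_rel.refl words)
  next
    case (cancel u v g b)
    then show ?case
      using word_rel.cancel[OF words[OF cancel(1)] words[OF cancel(2)], of "f g" b] range by simp
  next
    case (relator u v r)
    have "map (apfst f) r \<in> weyl_relators A"
      using relator(3)
    proof (unfold weyl_relators_def, elim UnE CollectE exE conjE, goal_cases)
      case (1 i)
      then show ?case using range by auto
    next
      case (2 i j m)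
      have "f i \<noteq> f j" using 2 inj by (auto simp: inj_on_def)
      moreover have "coxeter_exponent A (f i) (f j) = enat m"
        using 2 by (simp add: coxeter_exponent_def entry)
      ultimately show ?case using 2 range
        by (intro UnI2 CollectI exI[of _ "f i"] exI[of _ "f j"] exI[of _ m]) (simp add: map_concat)
    qed
    then show ?case
      using word_rel.relator[OF words[OF relator(1)] words[OF relator(2)] _ words[OF relator(4)]]
      by simp
  }
qed (auto intro: word_rel.sym word_rel.trans)

lemma elt_map:
  assumes "weyl_elt B xs = weyl_elt B ys" "sub.valid xs" "sub.valid ys"
  shows "weyl_elt A (map f xs) = weyl_elt A (map f ys)"
proof -
  have "(map (\<lambda>i. (i, False)) (map f xs), map (\<lambda>i. (i, False)) (map f ys)) \<in> rel"
    using assms rel_map[of "map (\<lambda>i. (i, False)) xs" "map (\<lambda>i. (i, False)) ys"]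
    by (simp add: sub.elt_eq_iff comp_def)
  then show ?thesis
    using elt_eq_iff[OF valid_map[OF assms(2)] valid_map[OF assms(3)]] by simp
qed

definition emb :: "(nat \<Rightarrow> int) \<Rightarrow> nat \<Rightarrow> int" where
  "emb x = (\<lambda>k. \<Sum>j<dim_row B. x j * simple_root (f j) k)"

lemma emb_root: "i < dim_row B \<Longrightarrow> emb (simple_root i) = simple_root (f i)"
  by (auto simp: emb_def simple_root_def[of i] if_distrib if_distribR cong: if_cong)

lemma reflect_emb:
  assumes "i < dim_row B"
  shows "reflect A (f i) (emb x) = emb (reflect B i x)"
proof -
  have p: "pairing A (f i) (emb x) = pairing B i x"
    unfolding emb_def pairing_sum
    using assms by (simp add: pairing_def[of B] pairing_root range entry mult.commute)
  have "emb (\<lambda>k. x k - c * simple_root i k) = (\<lambda>k. emb x k - c * emb (simple_root i) k)" for c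
    by (simp add: emb_def algebra_simps sum_subtractf sum_distrib_left)
  then show ?thesis unfolding reflect_def p by (simp add: emb_root[OF assms])
qed

lemma act_emb: "sub.valid ys \<Longrightarrow> act A (map f ys) (emb x) = emb (act B ys x)"
  by (induction ys) (auto simp: reflect_emb)

text \<open>
  The word \<open>ys\<close> lengthens \<open>xs\<close> letter by letter: before the letter \<open>i\<close> is appended, the previous
  part of \<open>ys\<close> sends the root of \<open>i\<close> to a nonnegative combination of the roots of \<open>B\<close>, and \<open>xs\<close>
  keeps all of those nonnegative.
\<close>

lemma length_coset_reduced:
  assumes "valid xs" and asc: "\<And>i. i < dim_row B \<Longrightarrow> word_length A xs < word_length A (xs @ [f i])"
    and "sub.valid ys" "word_length B ys = length ys"
  shows "word_length A (xs @ map f ys) = word_length A xs + length ys"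
  using assms(3,4)
proof (induction ys rule: rev_induct)
  case (snoc i ys)
  have v: "sub.valid ys" "i < dim_row B" using snoc.prems by auto
  have "act A (xs @ map f ys) (simple_root (f i)) l =
    (\<Sum>j<dim_row B. act B ys (simple_root i) j * act A xs (simple_root (f j)) l)" for l
  proof -
    have "act A (map f ys) (simple_root (f i)) = emb (act B ys (simple_root i))"
      using act_emb[OF v(1), of "simple_root i"] emb_root[OF v(2)] by simp
    then show ?thesis by (simp add: act_append emb_def act_sum)
  qed
  moreover have "0 \<le> act A xs (simple_root (f j)) l" if "j < dim_row B" for j l
    by (rule ascent_root_nonneg[OF assms(1) range[OF that] asc[OF that]])
  ultimately have "0 \<le> act A (xs @ map f ys) (simple_root (f i)) l" for l
    using sub.reduced_snoc(2)[OF snoc.prems] by (auto intro!: sum_nonneg mult_nonneg_nonneg)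
  then have "word_length A ((xs @ map f ys) @ [f i]) = Suc (word_length A (xs @ map f ys))"
    using assms(1) valid_map[OF v(1)] range[OF v(2)] by (intro ascent_length) auto
  then show ?case using snoc.IH[OF v(1) sub.reduced_snoc(1)[OF snoc.prems]] by simp
qed simp

lemma length_coset:
  assumes "valid xs" "\<And>i. i < dim_row B \<Longrightarrow> word_length A xs < word_length A (xs @ [f i])"
    and "sub.valid ys"
  shows "word_length A (xs @ map f ys) = word_length A xs + word_length B ys"
proof -
  obtain zs where zs: "sub.valid zs" "weyl_elt B zs = weyl_elt B ys" "word_length B zs = length zs"
    "length zs = word_length B ys"
    using sub.reduced_word_length[OF assms(3)] .
  have "weyl_elt A (xs @ map f zs) = weyl_elt A (xs @ map f ys)"
    by (rule elt_append[OF HOL.refl elt_map[OF zs(2)]]) (use assms zs valid_map in auto)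
  then have "word_length A (xs @ map f zs) = word_length A (xs @ map f ys)"
    by (rule word_length_cong)
  then show ?thesis using length_coset_reduced[OF assms(1,2) zs(1,3)] zs(4) by simp
qed

text \<open>
  Each of the two representatives is the other one times an element of the subgroup, so by
  \<open>length_coset\<close> each is at least as long as the other, and that element has length zero.
\<close>

lemma coset_unique:
  assumes xs: "valid xs" "\<And>i. i < dim_row B \<Longrightarrow> word_length A xs < word_length A (xs @ [f i])"
    and xs': "valid xs'" "\<And>i. i < dim_row B \<Longrightarrow> word_length A xs' < word_length A (xs' @ [f i])"
    and ys: "sub.valid ys" "sub.valid ys'"
    and eq: "weyl_elt A (xs @ map f ys) = weyl_elt A (xs' @ map f ys')"
  shows "weyl_elt A xs = weyl_elt A xs'" "weyl_elt B ys = weyl_elt B ys'"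
proof -
  have v: "sub.valid (ys' @ rev ys)" "sub.valid (ys @ rev ys')" using ys by auto
  have vm: "valid (map f ys)" "valid (map f ys')" using ys by (simp_all only: valid_map)
  have e: "weyl_elt A xs = weyl_elt A (xs' @ map f (ys' @ rev ys))"
    using elt_move_right[OF eq] xs(1) xs'(1) vm by (simp add: rev_map)
  then have 1: "word_length A xs = word_length A xs' + word_length B (ys' @ rev ys)"
    using length_coset[OF xs' v(1)] word_length_cong[OF e] by simp
  have e': "weyl_elt A xs' = weyl_elt A (xs @ map f (ys @ rev ys'))"
    using elt_move_right[OF eq[symmetric]] xs(1) xs'(1) vm by (simp add: rev_map)
  then have "word_length A xs' = word_length A xs + word_length B (ys @ rev ys')"
    using length_coset[OF xs v(2)] word_length_cong[OF e'] by simp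
  with 1 have "word_length B (ys' @ rev ys) = 0" by simp
  then have z: "weyl_elt B (ys' @ rev ys) = weyl_elt B []"
    using sub.word_length_0_iff[OF v(1)] by simp
  then show "weyl_elt B ys = weyl_elt B ys'"
    using sub.elt_move_right[OF z] ys by simp
  have "weyl_elt A (xs' @ map f (ys' @ rev ys)) = weyl_elt A (xs' @ map f [])"
    by (rule elt_append[OF HOL.refl elt_map[OF z]]) (use xs' v valid_map[OF v(1)] in auto)
  then show "weyl_elt A xs = weyl_elt A xs'" using e by simp
qed

lemma coset_exists:
  assumes "valid ws"
  shows "\<exists>xs ys. valid xs \<and> (\<forall>i<dim_row B. word_length A xs < word_length A (xs @ [f i])) \<and>
    sub.valid ys \<and> weyl_elt A (xs @ map f ys) = weyl_elt A ws"
  using assms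
proof (induction "word_length A ws" arbitrary: ws rule: less_induct)
  case less
  show ?case
  proof (cases "\<forall>i<dim_row B. word_length A ws < word_length A (ws @ [f i])")
    case True
    then show ?thesis using less.prems by (intro exI[of _ ws] exI[of _ "[]"]) simp
  next
    case False
    then obtain i where i: "i < dim_row B" "\<not> word_length A ws < word_length A (ws @ [f i])" by blast
    have fi: "f i < n" using range[OF i(1)] .
    have lt: "word_length A (ws @ [f i]) < word_length A ws"
      using word_length_snoc[OF less.prems fi] i(2) by auto
    have v: "valid (ws @ [f i])" using less.prems fi by simp
    obtain xs ys where xy: "valid xs" "\<forall>i<dim_row B. word_length A xs < word_length A (xs @ [f i])"
      "sub.valid ys" and e: "weyl_elt A (xs @ map f ys) = weyl_elt A (ws @ [f i])"
      using less.hyps[OF lt v] by blast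
    have "weyl_elt A ((xs @ map f ys) @ [f i]) = weyl_elt A ((ws @ [f i]) @ [f i])"
      by (rule elt_append[OF e HOL.refl]) (use xy(1) valid_map[OF xy(3)] fi less.prems in auto)
    also have "\<dots> = weyl_elt A ws" using elt_cancel[OF fi less.prems, of "[]"] by simp
    finally show ?thesis
      using xy i(1) by (intro exI[of _ xs] exI[of _ "ys @ [i]"]) simp
  qed
qed

text \<open>
  The identity \<open>W\<^sup>J(t) W\<^sub>J(t) = W(t)\<close>, where the second factor is the series of the abstract Weyl
  group of the submatrix.
\<close>

lemma poincare_parabolic:
  "growth_series (min_coset_reps A (f ` {..<dim_row B})) (weyl_length A) * poincare_series B =
    poincare_series A"
proof -
  let ?J = "f ` {..<dim_row B}"
  let ?h = "\<lambda>(w, u). weyl_elt A (weyl_word A w @ map f (weyl_word B u))"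
  have J: "?J \<subseteq> {..<n}" using range by auto
  have rep: "valid (weyl_word A w)" "weyl_elt A (weyl_word A w) = w"
    "\<And>i. i < dim_row B \<Longrightarrow> word_length A (weyl_word A w) < word_length A (weyl_word A w @ [f i])"
    if "w \<in> min_coset_reps A ?J" for w
  proof -
    have "w \<in> carrier (weyl_group A)" using that by (simp add: min_coset_reps_def)
    then show w: "valid (weyl_word A w)" "weyl_elt A (weyl_word A w) = w" by (rule weyl_word)+
    then show "word_length A (weyl_word A w) < word_length A (weyl_word A w @ [f i])"
      if "i < dim_row B" for i
      using elt_min_coset_reps[OF w(1) J] that \<open>w \<in> min_coset_reps A ?J\<close> by simp
  qed
  have "bij_betw ?h (min_coset_reps A ?J \<times> carrier (weyl_group B)) (carrier (weyl_group A))"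
    unfolding bij_betw_def
  proof
    show "inj_on ?h (min_coset_reps A ?J \<times> carrier (weyl_group B))"
    proof (rule inj_onI, clarify)
      fix w u w' u'
      assume w: "w \<in> min_coset_reps A ?J" "w' \<in> min_coset_reps A ?J"
        and u: "u \<in> carrier (weyl_group B)" "u' \<in> carrier (weyl_group B)"
        and e: "weyl_elt A (weyl_word A w @ map f (weyl_word B u)) =
          weyl_elt A (weyl_word A w' @ map f (weyl_word B u'))"
      note c = coset_unique[OF rep(1,3)[OF w(1)] rep(1,3)[OF w(2)]
          sub.weyl_word(1)[OF u(1)] sub.weyl_word(1)[OF u(2)] e]
      show "w = w' \<and> u = u'"
        using c unfolding rep(2)[OF w(1)] rep(2)[OF w(2)] sub.weyl_word(2)[OF u(1)]
          sub.weyl_word(2)[OF u(2)] by blast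
    qed
    show "?h ` (min_coset_reps A ?J \<times> carrier (weyl_group B)) = carrier (weyl_group A)"
    proof (intro equalityI subsetI)
      fix z assume "z \<in> ?h ` (min_coset_reps A ?J \<times> carrier (weyl_group B))"
      then obtain w u where wu: "w \<in> min_coset_reps A ?J" "u \<in> carrier (weyl_group B)"
        "z = weyl_elt A (weyl_word A w @ map f (weyl_word B u))" by auto
      then show "z \<in> carrier (weyl_group A)"
        using rep(1)[OF wu(1)] valid_map[OF sub.weyl_word(1)[OF wu(2)]]
        by (simp only: elt_carrier set_append Un_subset_iff)
    next
      fix z assume z: "z \<in> carrier (weyl_group A)"
      obtain xs ys where xy: "valid xs" "\<forall>i<dim_row B. word_length A xs < word_length A (xs @ [f i])"
        "sub.valid ys" "weyl_elt A (xs @ map f ys) = z"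
        using coset_exists[OF weyl_word(1)[OF z]] weyl_word(2)[OF z] by auto
      have w: "weyl_elt A xs \<in> min_coset_reps A ?J"
        using elt_min_coset_reps[OF xy(1) J] xy(2) by auto
      have u: "weyl_elt B ys \<in> carrier (weyl_group B)" using sub.elt_carrier[OF xy(3)] .
      have "?h (weyl_elt A xs, weyl_elt B ys) = weyl_elt A (xs @ map f ys)"
        unfolding prod.case
        by (rule elt_append[OF rep(2)[OF w] elt_map[OF sub.weyl_word(2)[OF u]]])
          (use rep(1)[OF w] sub.weyl_word(1)[OF u] xy valid_map in blast)+
      then show "z \<in> ?h ` (min_coset_reps A ?J \<times> carrier (weyl_group B))"
        using w u xy(4) by (metis (no_types, lifting) SigmaI image_eqI)
    qed
  qed
  moreover have "weyl_length A (?h p) = (\<lambda>(w, u). weyl_length A w + weyl_length B u) p"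
    if "p \<in> min_coset_reps A ?J \<times> carrier (weyl_group B)" for p
  proof -
    obtain w u where p: "p = (w, u)" "w \<in> min_coset_reps A ?J" "u \<in> carrier (weyl_group B)"
      using \<open>p \<in> _\<close> by blast
    then show ?thesis
      using length_coset[OF rep(1,3)[OF p(2)] sub.weyl_word(1)[OF p(3)]]
      by (simp add: word_length_def rep(2) sub.weyl_word(2))
  qed
  ultimately have "poincare_series A =
    growth_series (min_coset_reps A ?J \<times> carrier (weyl_group B)) (\<lambda>(w, u). weyl_length A w + weyl_length B u)"
    unfolding poincare_growth by (rule growth_series_bij)
  also have "\<dots> = growth_series (min_coset_reps A ?J) (weyl_length A) * poincare_series B"
    unfolding poincare_growth
  proof (rule growth_series_times[OF _ finite_weyl_length])
    show "finite {x \<in> min_coset_reps A ?J. weyl_length A x = k}" for k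
      by (rule finite_subset[OF _ finite_weyl_length[of A k]]) (auto simp: min_coset_reps_def)
  qed
  finally show ?thesis by simp
qed

end

section \<open>Direct sums of Cartan matrices\<close>

definition direct_sum :: "int mat \<Rightarrow> int mat \<Rightarrow> int mat" where
  "direct_sum A B = (let n = dim_row A; m = dim_row B in
     mat (n + m) (n + m) (\<lambda>(i, j).
       if i < n \<and> j < n then A $$ (i, j)
       else if n \<le> i \<and> n \<le> j then B $$ (i - n, j - n) else 0))"

lemma dim_direct_sum [simp]: "dim_row (direct_sum A B) = dim_row A + dim_row B"
  by (simp add: direct_sum_def Let_def)

lemma cartan_direct_sum:
  assumes "cartan A" "cartan B"
  shows "cartan (direct_sum A B)"
proof
  interpret A: cartan A by fact
  interpret B: cartan B by fact
  have "0 < dim_row A" using A.cartan unfolding cartan_matrix_def by blast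
  then show "cartan_matrix (dim_row (direct_sum A B)) (direct_sum A B)"
    unfolding cartan_matrix_def dim_direct_sum
    by (auto simp: direct_sum_def Let_def A.diag B.diag A.off_diag B.off_diag
        dest: A.zero_sym intro!: B.zero_sym split: if_splits)
qed

context
  fixes A B S :: "int mat" and g :: "nat \<Rightarrow> nat"
  assumes A: "cartan A" and B: "cartan B"
  defines "S \<equiv> direct_sum A B" and "g \<equiv> \<lambda>j. j + dim_row A"
begin

lemma direct_sum_left: "cartan_sub S A id"
  and direct_sum_right: "cartan_sub S B g"
  unfolding cartan_sub_def cartan_sub_axioms_def S_def g_def
  using cartan_direct_sum[OF A B] A B
  by (auto simp: direct_sum_def Let_def inj_on_def)

interpretation l: cartan_sub S A id by (rule direct_sum_left)
interpretation r: cartan_sub S B g by (rule direct_sum_right)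

lemma dim_S: "dim_row S = dim_row A + dim_row B" by (simp add: S_def)

lemma elt_commute_letter:
  assumes "i < dim_row A" "j < dim_row B"
  shows "weyl_elt S [g j, i] = weyl_elt S [i, g j]"
proof -
  have i: "i < dim_row S" and j: "g j < dim_row S" "g j \<noteq> i"
    using assms by (auto simp: dim_S g_def)
  have "coxeter_exponent S (g j) i = enat 2"
    using assms by (simp add: coxeter_exponent_def S_def g_def direct_sum_def Let_def numeral_eq_enat)
  then have "weyl_elt S (concat (replicate 2 [g j, i])) = weyl_elt S []"
    by (rule l.elt_braid[OF j(1) i j(2)])
  then have "weyl_elt S ([g j, i] @ [g j, i]) = weyl_elt S []" by (simp add: numeral_2_eq_2)
  then show ?thesis using l.elt_move_right[of "[g j, i]" "[g j, i]" "[]"] i j by simp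
qed

lemma elt_commute:
  assumes "l.sub.valid us" "j < dim_row B"
  shows "weyl_elt S (g j # us) = weyl_elt S (us @ [g j])"
  using assms(1)
proof (induction us)
  case (Cons i us)
  have v: "i < dim_row A" "l.sub.valid us" "l.valid us" "i < dim_row S" "g j < dim_row S"
    using Cons.prems assms(2) by (auto simp: dim_S g_def)
  have "weyl_elt S ([g j, i] @ us) = weyl_elt S ([i, g j] @ us)"
    by (rule l.elt_append[OF elt_commute_letter[OF v(1) assms(2)] HOL.refl]) (use v in auto)
  also have "\<dots> = weyl_elt S ([i] @ (g j # us))" by simp
  also have "\<dots> = weyl_elt S ([i] @ (us @ [g j]))"
    by (rule l.elt_append[OF HOL.refl Cons.IH[OF v(2)]]) (use v in auto)
  finally show ?case by simp
qed simp

lemma elt_sort: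
  assumes "l.valid ws"
  shows "\<exists>us vs. l.sub.valid us \<and> r.sub.valid vs \<and> weyl_elt S ws = weyl_elt S (us @ map g vs)"
  using assms
proof (induction ws)
  case (Cons i ws)
  then obtain us vs where uv: "l.sub.valid us" "r.sub.valid vs"
    and e: "weyl_elt S ws = weyl_elt S (us @ map g vs)" by auto
  have v: "l.valid us" "l.valid (map g vs)" "i < dim_row S" "l.valid ws"
    using Cons.prems l.valid_map[OF uv(1)] r.valid_map[OF uv(2)] by auto
  have "weyl_elt S ([i] @ ws) = weyl_elt S ([i] @ (us @ map g vs))"
    by (rule l.elt_append[OF HOL.refl e]) (use v in auto)
  then have i_ws: "weyl_elt S (i # ws) = weyl_elt S (i # us @ map g vs)" by simp
  show ?case
  proof (cases "i < dim_row A")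
    case True
    then show ?thesis using uv i_ws by (intro exI[of _ "i # us"] exI[of _ vs]) simp
  next
    case False
    define j where "j = i - dim_row A"
    have j: "j < dim_row B" "i = g j" using False v(3) by (auto simp: j_def dim_S g_def)
    have "weyl_elt S ((g j # us) @ map g vs) = weyl_elt S ((us @ [g j]) @ map g vs)"
      by (rule l.elt_append[OF elt_commute[OF uv(1) j(1)] HOL.refl]) (use v j in auto)
    then show ?thesis using uv i_ws j by (intro exI[of _ us] exI[of _ "j # vs"]) simp
  qed
qed (intro exI[of _ "[]"], simp)

lemma Nil_ascent: "i < dim_row A \<Longrightarrow> word_length S [] < word_length S ([] @ [id i])"
  using l.ascent_iff[of "[]" i] by (simp add: dim_S simple_root_nonneg)

lemma length_left: "l.sub.valid us \<Longrightarrow> word_length S us = word_length A us"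
  using l.length_coset[OF _ Nil_ascent, of us] l.word_length_0_iff[of "[]"] by simp

lemma act_left: "l.sub.valid us \<Longrightarrow> j < dim_row B \<Longrightarrow> act S us (simple_root (g j)) = simple_root (g j)"
proof (induction us)
  case (Cons i us)
  have "i < dim_row A" using Cons.prems by simp
  then have "pairing S i (simple_root (g j)) = 0"
    using Cons.prems by (subst pairing_root) (auto simp: S_def g_def direct_sum_def Let_def)
  then show ?case using Cons by (simp add: reflect_def)
qed simp

text \<open>
  Modulo the Weyl group of \<open>B\<close>, the minimal coset representatives of the Weyl group of the direct
  sum are the elements of the Weyl group of \<open>A\<close>, because the latter fix the roots of \<open>B\<close>. So the
  product formula for direct sums is a case of \<open>poincare_parabolic\<close>.
\<close>

lemma left_min_coset_reps:
  "bij_betw (\<lambda>u. weyl_elt S (weyl_word A u)) (carrier (weyl_group A))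
    (min_coset_reps S (g ` {..<dim_row B}))"
proof -
  let ?J = "g ` {..<dim_row B}"
  have J: "?J \<subseteq> {..<dim_row S}" by (auto simp: g_def dim_S)
  have val: "l.valid us" if "l.sub.valid us" for us
    using l.valid_map[OF that] by simp
  have asc: "word_length S us < word_length S (us @ [g j])"
    if "l.sub.valid us" "j < dim_row B" for us j
    using that l.ascent_iff[OF val[OF that(1)] r.range[OF that(2)]]
    by (simp add: act_left simple_root_nonneg)
  have mem: "weyl_elt S us \<in> min_coset_reps S ?J" if "l.sub.valid us" for us
    using l.elt_min_coset_reps[OF val[OF that] J] asc[OF that] by simp
  show ?thesis
    unfolding bij_betw_def
  proof (intro conjI inj_onI)
    fix u u' assume u: "u \<in> carrier (weyl_group A)" "u' \<in> carrier (weyl_group A)"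
      and e: "weyl_elt S (weyl_word A u) = weyl_elt S (weyl_word A u')"
    have "weyl_elt A (weyl_word A u) = weyl_elt A (weyl_word A u')"
      by (rule l.coset_unique(2)[OF _ Nil_ascent _ Nil_ascent
            l.sub.weyl_word(1)[OF u(1)] l.sub.weyl_word(1)[OF u(2)]])
        (simp_all add: e)
    then show "u = u'" using l.sub.weyl_word(2)[OF u(1)] l.sub.weyl_word(2)[OF u(2)] by simp
  next
    show "(\<lambda>u. weyl_elt S (weyl_word A u)) ` carrier (weyl_group A) = min_coset_reps S ?J"
    proof (intro equalityI subsetI)
      fix w assume "w \<in> (\<lambda>u. weyl_elt S (weyl_word A u)) ` carrier (weyl_group A)"
      then show "w \<in> min_coset_reps S ?J" using mem l.sub.weyl_word(1) by blast
    next
      fix w assume w: "w \<in> min_coset_reps S ?J"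
      then have C: "w \<in> carrier (weyl_group S)" by (simp add: min_coset_reps_def)
      define ws where "ws = weyl_word S w"
      have ws: "l.valid ws" "weyl_elt S ws = w" using l.weyl_word[OF C] by (auto simp: ws_def)
      have ws_asc: "word_length S ws < word_length S (ws @ [g j])" if "j < dim_row B" for j
        using l.elt_min_coset_reps[OF ws(1) J] w ws(2) that by simp
      obtain us vs where uv: "l.sub.valid us" "r.sub.valid vs"
        and e: "weyl_elt S ws = weyl_elt S (us @ map g vs)"
        using elt_sort[OF ws(1)] by blast
      have "weyl_elt S ws = weyl_elt S us"
        using r.coset_unique(1)[of ws us "[]" vs] ws(1) ws_asc val[OF uv(1)] asc[OF uv(1)] uv(2) e
        by simp
      moreover define u where "u = weyl_elt A us"
      have u: "u \<in> carrier (weyl_group A)" unfolding u_def by (rule l.sub.elt_carrier[OF uv(1)])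
      have "weyl_elt S (map id (weyl_word A u)) = weyl_elt S (map id us)"
        by (rule l.elt_map) (use l.sub.weyl_word[OF u] uv(1) u_def in auto)
      ultimately show "w \<in> (\<lambda>u. weyl_elt S (weyl_word A u)) ` carrier (weyl_group A)"
        using u ws(2) by (intro image_eqI[of _ _ u]) simp_all
    qed
  qed
qed

lemma poincare_direct_sum: "poincare_series S = poincare_series A * poincare_series B"
proof -
  have "weyl_length S (weyl_elt S (weyl_word A u)) = weyl_length A u"
    if "u \<in> carrier (weyl_group A)" for u
    using length_left[OF l.sub.weyl_word(1)[OF that]] l.sub.weyl_word(2)[OF that]
    by (simp add: word_length_def)
  then have "growth_series (min_coset_reps S (g ` {..<dim_row B})) (weyl_length S) = poincare_series A"
    unfolding poincare_growth by (intro growth_series_bij[OF left_min_coset_reps])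
  then show ?thesis using r.poincare_parabolic by simp
qed

end

section \<open>The alternating sum\<close>

lemma alternating_sum_Pow:
  assumes "finite S" "S \<noteq> {}"
  shows "(\<Sum>J\<in>Pow S. (- 1) ^ card J) = (0 :: int)"
proof -
  have "(\<Prod>x\<in>S. 1 - 1) = (\<Sum>J\<in>Pow S. (- 1) ^ card J * (\<Prod>x\<in>J. 1) * (\<Prod>x\<in>S - J. 1 :: int))"
    by (rule prod_diff_conv_sum[OF assms(1)])
  then have "(\<Sum>J\<in>Pow S. (- 1) ^ card J) = (0 :: int) ^ card S" by simp
  then show ?thesis using assms by (simp add: card_gt_0_iff)
qed

context cartan
begin

text \<open>
  The element \<open>w\<close> lies in \<open>min_coset_reps A J\<close> exactly if \<open>J\<close> consists of ascents of \<open>w\<close>. So after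
  exchanging the sums \<open>w\<close> contributes the alternating sum over the subsets of its set of ascents,
  which vanishes unless that set is empty; and an element without ascents exists only in a
  finite Weyl group.
\<close>

lemma alternating_sum_zero:
  assumes inf: "infinite (carrier (weyl_group A))"
  shows "(\<Sum>J\<in>Pow {..<n}. (- 1) ^ card J * growth_series (min_coset_reps A J) (weyl_length A)) = 0"
proof (rule fps_ext)
  fix k
  define Z where "Z = {w \<in> carrier (weyl_group A). weyl_length A w = k}"
  define asc where "asc w = {i. i < n \<and>
    weyl_length A w < weyl_length A (w \<otimes>\<^bsub>weyl_group A\<^esub> weyl_elt A [i])}" for w
  have finZ: "finite Z" unfolding Z_def by (rule finite_weyl_length)
  have asc: "asc w \<noteq> {}" if "w \<in> Z" for w
  proof
    assume empty: "asc w = {}"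
    have C: "w \<in> carrier (weyl_group A)" using that by (simp add: Z_def)
    note xs = weyl_word[OF C]
    have "word_length A (weyl_word A w @ [i]) < word_length A (weyl_word A w)" if i: "i < n" for i
    proof -
      have "w \<otimes>\<^bsub>weyl_group A\<^esub> weyl_elt A [i] = weyl_elt A (weyl_word A w @ [i])"
        using elt_mult[of "weyl_word A w" "[i]"] xs i by simp
      then have "\<not> word_length A (weyl_word A w) < word_length A (weyl_word A w @ [i])"
        using empty i xs(2) by (auto simp: asc_def word_length_def)
      then show ?thesis using word_length_snoc[OF xs(1) i] by auto
    qed
    then show False using finite_if_all_descents[OF xs(1)] inf by blast
  qed
  have coeff: "fps_nth ((- 1) ^ card J * growth_series (min_coset_reps A J) (weyl_length A)) k =
      (\<Sum>w\<in>Z. if J \<subseteq> asc w then (- 1) ^ card J else 0)" if "J \<in> Pow {..<n}" for J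
  proof -
    have "{w \<in> min_coset_reps A J. weyl_length A w = k} = {w \<in> Z. J \<subseteq> asc w}"
      using that by (auto simp: min_coset_reps_def Z_def asc_def)
    then have "fps_nth (growth_series (min_coset_reps A J) (weyl_length A)) k = (\<Sum>w\<in>Z. if J \<subseteq> asc w then 1 else 0)"
      using finZ by (simp add: growth_series_def sum.If_cases Int_def)
    then show ?thesis
      by (cases "even (card J)") (simp_all add: sum_negf[symmetric] if_distrib cong: if_cong)
  qed
  have "fps_nth (\<Sum>J\<in>Pow {..<n}. (- 1) ^ card J * growth_series (min_coset_reps A J) (weyl_length A)) k =
    (\<Sum>J\<in>Pow {..<n}. \<Sum>w\<in>Z. if J \<subseteq> asc w then (- 1) ^ card J else 0)"
    unfolding fps_sum_nth by (intro sum.cong HOL.refl coeff)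
  also have "\<dots> = (\<Sum>w\<in>Z. \<Sum>J\<in>Pow {..<n}. if J \<subseteq> asc w then (- 1) ^ card J else 0)"
    by (rule sum.swap)
  also have "\<dots> = (\<Sum>w\<in>Z. \<Sum>J\<in>Pow (asc w). (- 1) ^ card J)"
  proof (rule sum.cong[OF HOL.refl])
    fix w
    have "Pow (asc w) = {J \<in> Pow {..<n}. J \<subseteq> asc w}" by (auto simp: asc_def)
    then show "(\<Sum>J\<in>Pow {..<n}. if J \<subseteq> asc w then (- 1) ^ card J else 0) = (\<Sum>J\<in>Pow (asc w). (- 1 :: int) ^ card J)"
      by (simp only: sum.inter_filter finite_Pow_iff finite_lessThan)
  qed
  also have "\<dots> = (\<Sum>w\<in>Z. 0)"
    using asc by (intro sum.cong HOL.refl alternating_sum_Pow) (auto simp: asc_def)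
  finally show "fps_nth (\<Sum>J\<in>Pow {..<n}. (- 1) ^ card J * growth_series (min_coset_reps A J) (weyl_length A)) k
    = fps_nth 0 k" by simp
qed

lemma length_one: "weyl_length A (weyl_elt A []) = 0"
  using word_length_0_iff[of "[]"] by (simp add: word_length_def)

lemma min_coset_reps_all: "min_coset_reps A {..<n} = {weyl_elt A []}"
proof (intro equalityI subsetI)
  fix w assume w: "w \<in> min_coset_reps A {..<n}"
  then have "w \<in> carrier (weyl_group A)" by (simp add: min_coset_reps_def)
  then obtain ys where ys: "valid ys" "weyl_elt A ys = w" "word_length A ys = length ys"
    using weyl_word reduced_word_length by metis
  show "w \<in> {weyl_elt A []}"
  proof (cases ys rule: rev_cases)
    case (snoc zs i)
    have v: "valid zs" "i < n" using ys(1) snoc by auto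
    have "word_length A ys < word_length A (ys @ [i])"
      using elt_min_coset_reps[OF ys(1), of "{..<n}"] w ys(2) v(2) by simp
    also have "\<dots> = word_length A zs"
      using elt_cancel[OF v(2) v(1), of "[]"] snoc by (intro word_length_cong) simp
    also have "\<dots> \<le> length zs" by (rule word_length_le[OF v(1) HOL.refl])
    finally show ?thesis using ys(3) snoc by simp
  qed (use ys in simp)
next
  fix w assume "w \<in> {weyl_elt A []}"
  moreover have "word_length A [] < word_length A ([] @ [i])" if "i < n" for i
    using that ascent_iff[of "[]" i] by (simp add: simple_root_def)
  ultimately show "w \<in> min_coset_reps A {..<n}"
    using elt_min_coset_reps[of "[]" "{..<n}"] by simp
qed

lemma min_coset_reps_empty: "min_coset_reps A {} = carrier (weyl_group A)"
  by (simp add: min_coset_reps_def)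

lemma growth_min_coset_reps_all: "growth_series (min_coset_reps A {..<n}) (weyl_length A) = 1"
proof (rule fps_ext)
  fix k
  have "{x \<in> {weyl_elt A []}. weyl_length A x = k} = (if k = 0 then {weyl_elt A []} else {})"
    using length_one by auto
  then show "fps_nth (growth_series (min_coset_reps A {..<n}) (weyl_length A)) k = fps_nth 1 k"
    unfolding min_coset_reps_all growth_series_def by simp
qed

lemma finite_if_polynomial:
  assumes "poincare_series A = fps_of_poly p"
  shows "finite (carrier (weyl_group A))"
proof (rule finite_subset)
  show "carrier (weyl_group A) \<subseteq> (\<Union>k\<le>degree p. {w \<in> carrier (weyl_group A). weyl_length A w = k})"
  proof
    fix w assume w: "w \<in> carrier (weyl_group A)"
    let ?k = "weyl_length A w"
    have "card {x \<in> carrier (weyl_group A). weyl_length A x = ?k} \<noteq> 0"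
      using w finite_weyl_length[of A ?k] by auto
    moreover have "coeff p ?k = int (card {x \<in> carrier (weyl_group A). weyl_length A x = ?k})"
      using arg_cong[OF assms, of "\<lambda>f. fps_nth f ?k"] by (simp add: poincare_series_def)
    ultimately have "coeff p ?k \<noteq> 0" by simp
    then have "?k \<le> degree p" by (rule le_degree)
    then show "w \<in> (\<Union>k\<le>degree p. {w \<in> carrier (weyl_group A). weyl_length A w = k})" using w by simp
  qed
qed (simp add: finite_weyl_length)

lemma poincare_nonzero: "poincare_series A \<noteq> 0"
proof
  assume "poincare_series A = 0"
  then have "fps_nth (poincare_series A) 0 = 0" by simp
  then have "card {x \<in> carrier (weyl_group A). weyl_length A x = 0} = 0"
    by (simp add: poincare_series_def)
  then have "{x \<in> carrier (weyl_group A). weyl_length A x = 0} = {}"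
    using finite_weyl_length[of A 0] by simp
  then show False using length_one elt_carrier[of "[]"] by auto
qed

end

text \<open>
  The type \<open>A\<^sub>1\<close> supplies a denominator for the summands that need none, namely the empty
  sum and the empty subset of indices, since a Cartan matrix has positive size.
\<close>

definition rank_one :: "int mat" where
  "rank_one = mat 1 1 (\<lambda>_. 2)"

lemma cartan_rank_one: "cartan rank_one"
  by unfold_locales (simp add: rank_one_def cartan_matrix_def)

lemma poincare_rank_one: "\<exists>p. poincare_series rank_one = fps_of_poly p"
proof -
  interpret cartan rank_one by (rule cartan_rank_one)
  have n: "dim_row rank_one = 1" by (simp add: rank_one_def)
  have "word_length rank_one ([0] @ [i]) < word_length rank_one [0]" if "i < n" for i
    using that descent_iff[of "[0]" i] n by (simp add: reflect_own_root simple_root_nonneg)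
  then have "finite (carrier (weyl_group rank_one))"
    using finite_if_all_descents[of "[0]"] n by simp
  then show ?thesis unfolding poincare_growth by (rule growth_series_finite)
qed

section \<open>Fractions whose denominator is a finite Poincare series\<close>

text \<open>
  This says that \<open>f / P\<close> is a polynomial divided by the Poincare polynomial of a finite Weyl
  group. Finiteness is expressed by the series being a polynomial, which is what common
  denominators require; with \<open>finite_type\<close> in its place the sum of two fractions would need the
  finiteness of the Weyl group of a matrix of finite type.
\<close>

definition finite_fraction :: "int fps \<Rightarrow> int fps \<Rightarrow> bool" where
  "finite_fraction P f \<longleftrightarrow> (\<exists>B p Q. cartan B \<and> poincare_series B = fps_of_poly p \<and>
     f * poincare_series B = P * fps_of_poly Q)"

lemma finite_fraction_zero: "finite_fraction P 0"
proof -
  obtain p where "poincare_series rank_one = fps_of_poly p" using poincare_rank_one by blast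
  then show ?thesis unfolding finite_fraction_def
    using cartan_rank_one by (intro exI[of _ rank_one] exI[of _ p] exI[of _ 0]) simp
qed

lemma finite_fraction_self: "finite_fraction P P"
proof -
  obtain p where "poincare_series rank_one = fps_of_poly p" using poincare_rank_one by blast
  then show ?thesis unfolding finite_fraction_def
    using cartan_rank_one by (intro exI[of _ rank_one] exI[of _ p] exI[of _ p]) simp
qed

lemma finite_fraction_uminus:
  assumes "finite_fraction P f"
  shows "finite_fraction P (- f)"
proof -
  obtain B p Q where "cartan B" "poincare_series B = fps_of_poly p"
    "f * poincare_series B = P * fps_of_poly Q"
    using assms unfolding finite_fraction_def by blast
  then show ?thesis unfolding finite_fraction_def
    by (intro exI[of _ B] exI[of _ p] exI[of _ "- Q"]) (simp add: fps_of_poly_uminus)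
qed

lemma finite_fraction_sign: "finite_fraction P f \<Longrightarrow> finite_fraction P ((- 1) ^ k * f)"
  using finite_fraction_uminus by (cases "even k") auto

text \<open>
  The direct sum of the two matrices has the product of the two denominators as its series.
\<close>

lemma finite_fraction_add:
  assumes "finite_fraction P f" "finite_fraction P f'"
  shows "finite_fraction P (f + f')"
proof -
  obtain B p Q where B: "cartan B" "poincare_series B = fps_of_poly p"
    "f * poincare_series B = P * fps_of_poly Q"
    using assms(1) unfolding finite_fraction_def by blast
  obtain B' p' Q' where B': "cartan B'" "poincare_series B' = fps_of_poly p'"
    "f' * poincare_series B' = P * fps_of_poly Q'"
    using assms(2) unfolding finite_fraction_def by blast
  have S: "poincare_series (direct_sum B B') = poincare_series B * poincare_series B'"
    by (rule poincare_direct_sum[OF B(1) B'(1)])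
  have "(f + f') * poincare_series (direct_sum B B') =
    (f * poincare_series B) * poincare_series B' + (f' * poincare_series B') * poincare_series B"
    unfolding S by (simp add: algebra_simps)
  also have "\<dots> = P * fps_of_poly (Q * p' + Q' * p)"
    unfolding B(3) B'(3) by (simp add: B(2) B'(2) fps_of_poly_add fps_of_poly_mult algebra_simps)
  finally have "(f + f') * poincare_series (direct_sum B B') = P * fps_of_poly (Q * p' + Q' * p)" .
  moreover have "poincare_series (direct_sum B B') = fps_of_poly (p * p')"
    using S B(2) B'(2) by (simp add: fps_of_poly_mult)
  ultimately show ?thesis
    unfolding finite_fraction_def using cartan_direct_sum[OF B(1) B'(1)] by blast
qed

lemma finite_fraction_sum:
  "finite I \<Longrightarrow> (\<And>i. i \<in> I \<Longrightarrow> finite_fraction P (f i)) \<Longrightarrow> finite_fraction P (\<Sum>i\<in>I. f i)"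
  by (induction I rule: finite_induct) (auto intro: finite_fraction_zero finite_fraction_add)

text \<open>
  Since \<open>W\<^sup>J(t) / W(t) = 1 / W\<^sub>J(t)\<close>, the claim for \<open>W\<^sup>J\<close> over \<open>W\<close> is the claim for \<open>1\<close> over the
  series of a smaller submatrix.
\<close>

lemma (in cartan) finite_fraction_min_coset_reps:
  assumes J: "J \<subset> {..<n}"
    and smaller: "\<And>B. cartan B \<Longrightarrow> dim_row B < n \<Longrightarrow> finite_fraction (poincare_series B) 1"
  shows "finite_fraction (poincare_series A) (growth_series (min_coset_reps A J) (weyl_length A))"
proof (cases "J = {}")
  case True
  then show ?thesis
    using finite_fraction_self by (simp add: min_coset_reps_empty poincare_growth)
next
  case False
  have finJ: "finite J" using J by (meson finite_lessThan finite_subset psubset_imp_subset)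
  define m where "m = card J"
  have m: "0 < m" "m < n"
    using False finJ psubset_card_mono[OF _ J] by (auto simp: m_def card_gt_0_iff)
  obtain f where f: "bij_betw f {..<m} J"
    using ex_bij_betw_nat_finite[OF finJ] by (auto simp: m_def lessThan_atLeast0)
  define B where "B = mat m m (\<lambda>(i, j). A $$ (f i, f j))"
  have dim: "dim_row B = m" by (simp add: B_def)
  have range: "f i < n" if "i < m" for i
    using f J that by (auto simp: bij_betw_def)
  have inj: "inj_on f {..<m}" using f by (simp add: bij_betw_def)
  have "cartan B"
  proof
    show "cartan_matrix (dim_row B) B"
      unfolding dim cartan_matrix_def
      using m(1) range inj by (auto simp: B_def diag off_diag inj_on_eq_iff dest: zero_sym)
  qed
  then interpret B: cartan_sub A B f
    unfolding cartan_sub_def cartan_sub_axioms_def dim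
    using inj range cartan_axioms by (auto simp: B_def)
  obtain B' p Q where B': "cartan B'" "poincare_series B' = fps_of_poly p"
    "1 * poincare_series B' = poincare_series B * fps_of_poly Q"
    using smaller[OF \<open>cartan B\<close>] m(2) unfolding dim finite_fraction_def by blast
  have "growth_series (min_coset_reps A J) (weyl_length A) * poincare_series B = poincare_series A"
    using B.poincare_parabolic f dim by (simp add: bij_betw_def)
  then have "growth_series (min_coset_reps A J) (weyl_length A) * poincare_series B' =
    poincare_series A * fps_of_poly Q"
    using B'(3) by (simp add: mult.assoc[symmetric])
  then show ?thesis unfolding finite_fraction_def using B' by blast
qed

text \<open>
  For an infinite Weyl group the summand of the full index set is \<open>\<plusminus> 1\<close> in the alternating sum,
  so \<open>1\<close> is a signed sum of the series \<open>W\<^sup>J(t)\<close> of the proper subsets \<open>J\<close>.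
\<close>

lemma finite_fraction_one: "cartan A \<Longrightarrow> finite_fraction (poincare_series A) 1"
proof (induction "dim_row A" arbitrary: A rule: less_induct)
  case less
  interpret cartan A by fact
  let ?f = "\<lambda>J. (- 1) ^ card J * growth_series (min_coset_reps A J) (weyl_length A)"
  show ?case
  proof (cases "finite (carrier (weyl_group A))")
    case True
    then obtain p where "poincare_series A = fps_of_poly p"
      using growth_series_finite unfolding poincare_growth by blast
    then show ?thesis unfolding finite_fraction_def
      using less.prems by (intro exI[of _ A] exI[of _ p] exI[of _ 1]) simp
  next
    case False
    have "(\<Sum>J\<in>Pow {..<n}. ?f J) = ?f {..<n} + (\<Sum>J\<in>Pow {..<n} - {{..<n}}. ?f J)"
      by (rule sum.remove) auto
    then have "(- 1) ^ n = - (\<Sum>J\<in>Pow {..<n} - {{..<n}}. ?f J)"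
      using alternating_sum_zero[OF False] growth_min_coset_reps_all by (simp add: eq_neg_iff_add_eq_0)
    moreover have "finite_fraction (poincare_series A) (- (\<Sum>J\<in>Pow {..<n} - {{..<n}}. ?f J))"
      using less.hyps
      by (intro finite_fraction_uminus finite_fraction_sum finite_fraction_sign
          finite_fraction_min_coset_reps) auto
    ultimately have "finite_fraction (poincare_series A) ((- 1) ^ n)" by simp
    then have "finite_fraction (poincare_series A) ((- 1) ^ n * (- 1) ^ n)"
      by (rule finite_fraction_sign)
    then show ?thesis by (simp add: power_mult_distrib[symmetric])
  qed
qed

theorem mainTheorem4:
  fixes A :: "int mat" and n :: nat
  assumes "cartan_matrix n A"
    and "\<not> finite_type A"
  shows "\<exists>n' A' (Q' :: int poly).
    cartan_matrix n' A' \<and> finite_type A' \<and>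
    Q' \<noteq> 0 \<and> poincare_series A * fps_of_poly Q' = poincare_series A'"
proof -
  have "dim_row A = n" using assms(1) unfolding cartan_matrix_def by auto
  then have "cartan A" using assms(1) by (simp add: cartan_def)
  then obtain A' p Q where A': "cartan A'" "poincare_series A' = fps_of_poly p"
    "1 * poincare_series A' = poincare_series A * fps_of_poly Q"
    using finite_fraction_one unfolding finite_fraction_def by blast
  interpret A': cartan A' by fact
  have "finite_type A'"
    by (rule A'.finite_imp_finite_type[OF A'.finite_if_polynomial[OF A'(2)]])
  moreover have "Q \<noteq> 0" using A'(3) A'.poincare_nonzero by auto
  ultimately show ?thesis using A'.cartan A'(3) by (metis mult_1)
qed

end
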